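(* Let $b$ be a normalizing function with index $\alpha=2$, and let $\mathcal{S}$ be a vector subspace of $\mathbb{W}_b$ such that any two elements $X_1,X_2$ of $\mathcal{S}$ (not both zero) are jointly regularly varying with normalizing function $b$. Then the inner product on $\mathcal{S}$ inducing the norm $\|\cdot\|_b$ is given by the tail pairwise dependence measure: for $X_1,X_2\in\mathcal{S}$, $$\langle X_1,X_2\rangle=\sigma(X_1,X_2)=\int_{\mathbb{S}^1}\omega_1\omega_2\,dH_{\boldsymbol{X}}(\boldsymbol{\omega}),$$ where $H_{\boldsymbol{X}}$ is the angular measure of $\boldsymbol{X}=(X_1,X_2)$.
   Context: A measurable function $L:(0,\infty)\to(0,\infty)$ is slowly varying if $\lim_{s\to\infty} L(sx)/L(s)=1$ for all $x>0$. A normalizing function with index $\alpha>0$ is a function $b(s)=s^{\alpha}L(s)$ with $L$ slowly varying. Fix a probability space $(\Omega,\Sigma,\mathbb{P})$. $\mathbb{V}_b$ is the set of real-valued random variables $X$ on it such that for every $x>0$ the limits $\lim_{s\to\infty} b(s)\mathbb{P}(X>sx)$ and $\lim_{s\to\infty} b(s)\mathbb{P}(X<-sx)$ exist and are finite; $\mathcal{N}_b$ is the set of $X\in\mathbb{V}_b$ for which all these limits are $0$. $\mathbb{W}_b=\mathbb{V}_b/\mathcal{N}_b$ is the quotient space of equivalence classes under $X\sim_b Y\iff X-Y\in\mathcal{N}_b$, with $\|[X]\|_b=\|X\|_b=\{\lim_{s\to\infty} b(s)\mathbb{P}(|X|>s)\}^{1/\alpha}$. Elements of $\mathbb{W}_b$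 are handled through representatives in $\mathbb{V}_b$. A random vector $\boldsymbol{X}=(X_1,X_2)$ is (jointly) regularly varying with normalizing function $b$ if $b(s)\mathbb{P}(s^{-1}\boldsymbol{X}\in\cdot)$ converges vaguely as $s\to\infty$ to a nonzero Radon measure $\nu_{\boldsymbol{X}}$ on the Borel sets of $[-\infty,\infty]^2\setminus\{\boldsymbol{0}\}$ that puts no mass on $[-\infty,\infty]^2\setminus(-\infty,\infty)^2$. Its angular measure $H_{\boldsymbol{X}}$ is the finite Borel measure on the Euclidean unit circle $\mathbb{S}^1$ determined by $\nu_{\boldsymbol{X}}(\{x:\|x\|>r,\ x/\|x\|\in B\})=r^{-\alpha}H_{\boldsymbol{X}}(B)$ for $r>0$ and Borel $B\subset\mathbb{S}^1$, with $\|\cdot\|$ the Euclidean norm. The tail pairwise dependence measure is $$\sigma(X_1,X_2)=\int_{\mathbb{S}^1}\operatorname{sgn}(\omega_1)\operatorname{sgn}(\omega_2)|\omega_1|^{\alpha/2}|\omega_2|^{\alpha/2}\,dH_{\boldsymbol{X}}(\boldsymbol{\omega}),$$ which for $\alpha=2$ equals $\int_{\mathbb{S}^1}\omega_1\omega_2\,dH_{\boldsymbol{X}}(\boldsymbol{\omega})$. When $X_1$ and $X_2$ are both the zero class, $H_{\boldsymbol{X}}$ is taken to be the zero measure. *)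

theory Defs
  imports "HOL-Probability.Probability"
begin

definition slowly_varying :: "(real \<Rightarrow> real) \<Rightarrow> bool" where
  "slowly_varying L \<longleftrightarrow>
     L \<in> borel_measurable (restrict_space borel {0<..}) \<and>
     (\<forall>s>0. L s > 0) \<and>
     (\<forall>x>0. ((\<lambda>s. L (s * x) / L s) \<longlongrightarrow> 1) at_top)"

text \<open>Only the values of \<open>b\<close> on the positive reals are constrained (and used).\<close>

definition normalizing_function :: "(real \<Rightarrow> real) \<Rightarrow> real \<Rightarrow> bool" where
  "normalizing_function b \<alpha> \<longleftrightarrow>
     \<alpha> > 0 \<and> (\<exists>L. slowly_varying L \<and> (\<forall>s>0. b s = s powr \<alpha> * L s))"

definition V_space :: "'a measure \<Rightarrow> (real \<Rightarrow> real) \<Rightarrow> ('a \<Rightarrow> real) set" where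
  "V_space M b = {X \<in> borel_measurable M. \<forall>x>0.
     (\<exists>l. ((\<lambda>s. b s * measure M {w \<in> space M. X w > s * x}) \<longlongrightarrow> l) at_top) \<and>
     (\<exists>l. ((\<lambda>s. b s * measure M {w \<in> space M. X w < - (s * x)}) \<longlongrightarrow> l) at_top)}"

definition N_space :: "'a measure \<Rightarrow> (real \<Rightarrow> real) \<Rightarrow> ('a \<Rightarrow> real) set" where
  "N_space M b = {X \<in> V_space M b. \<forall>x>0.
     ((\<lambda>s. b s * measure M {w \<in> space M. X w > s * x}) \<longlongrightarrow> 0) at_top \<and>
     ((\<lambda>s. b s * measure M {w \<in> space M. X w < - (s * x)}) \<longlongrightarrow> 0) at_top}"

definition tail_rel :: "'a measure \<Rightarrow> (real \<Rightarrow> real) \<Rightarrow> (('a \<Rightarrow> real) \<times> ('a \<Rightarrow> real)) set" where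
  "tail_rel M b = {(X, Y). X \<in> V_space M b \<and> Y \<in> V_space M b \<and> (\<lambda>w. X w - Y w) \<in> N_space M b}"

definition W_space :: "'a measure \<Rightarrow> (real \<Rightarrow> real) \<Rightarrow> ('a \<Rightarrow> real) set set" where
  "W_space M b = V_space M b // tail_rel M b"

definition W_zero :: "'a measure \<Rightarrow> (real \<Rightarrow> real) \<Rightarrow> ('a \<Rightarrow> real) set" where
  "W_zero M b = tail_rel M b `` {\<lambda>w. 0}"

text \<open>
  The set \<open>V_space M b\<close> need not be closed under addition, so addition of classes is a partial
  operation: if the sum of representatives is not in \<open>V_space M b\<close>, then \<open>W_add\<close> returns the
  empty set, which is not an element of \<open>W_space M b\<close>. Closure of a subset of \<open>W_space M b\<close>
  under \<open>W_add\<close> therefore includes the requirement that the sums are defined.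
\<close>

definition W_add :: "'a measure \<Rightarrow> (real \<Rightarrow> real) \<Rightarrow> ('a \<Rightarrow> real) set \<Rightarrow> ('a \<Rightarrow> real) set \<Rightarrow> ('a \<Rightarrow> real) set" where
  "W_add M b C D = (\<Union>X\<in>C. \<Union>Y\<in>D. tail_rel M b `` {\<lambda>w. X w + Y w})"

definition W_scale :: "'a measure \<Rightarrow> (real \<Rightarrow> real) \<Rightarrow> real \<Rightarrow> ('a \<Rightarrow> real) set \<Rightarrow> ('a \<Rightarrow> real) set" where
  "W_scale M b a C = (\<Union>X\<in>C. tail_rel M b `` {\<lambda>w. a * X w})"

definition W_subspace :: "'a measure \<Rightarrow> (real \<Rightarrow> real) \<Rightarrow> ('a \<Rightarrow> real) set set \<Rightarrow> bool" where
  "W_subspace M b S \<longleftrightarrow>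
     S \<subseteq> W_space M b \<and> W_zero M b \<in> S \<and>
     (\<forall>C\<in>S. \<forall>D\<in>S. W_add M b C D \<in> S) \<and>
     (\<forall>a. \<forall>C\<in>S. W_scale M b a C \<in> S)"

definition V_norm :: "'a measure \<Rightarrow> (real \<Rightarrow> real) \<Rightarrow> real \<Rightarrow> ('a \<Rightarrow> real) \<Rightarrow> real" where
  "V_norm M b \<alpha> X =
     (Lim at_top (\<lambda>s. b s * measure M {w \<in> space M. \<bar>X w\<bar> > s})) powr (1 / \<alpha>)"

text \<open>\<open>V_norm\<close> is constant on each class; \<open>W_norm\<close> is the common value.\<close>

definition W_norm :: "'a measure \<Rightarrow> (real \<Rightarrow> real) \<Rightarrow> real \<Rightarrow> ('a \<Rightarrow> real) set \<Rightarrow> real" where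
  "W_norm M b \<alpha> C = the_elem (V_norm M b \<alpha> ` C)"

definition W_inner_product ::
  "'a measure \<Rightarrow> (real \<Rightarrow> real) \<Rightarrow> ('a \<Rightarrow> real) set set \<Rightarrow>
   (('a \<Rightarrow> real) set \<Rightarrow> ('a \<Rightarrow> real) set \<Rightarrow> real) \<Rightarrow> bool" where
  "W_inner_product M b S ip \<longleftrightarrow>
     (\<forall>C\<in>S. \<forall>D\<in>S. ip C D = ip D C) \<and>
     (\<forall>C\<in>S. \<forall>D\<in>S. \<forall>E\<in>S. ip (W_add M b C D) E = ip C E + ip D E) \<and>
     (\<forall>a. \<forall>C\<in>S. \<forall>D\<in>S. ip (W_scale M b a C) D = a * ip C D) \<and>
     (\<forall>C\<in>S. ip C C \<ge> 0) \<and>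
     (\<forall>C\<in>S. ip C C = 0 \<longleftrightarrow> C = W_zero M b)"

definition W_induces_norm ::
  "'a measure \<Rightarrow> (real \<Rightarrow> real) \<Rightarrow> real \<Rightarrow> ('a \<Rightarrow> real) set set \<Rightarrow>
   (('a \<Rightarrow> real) set \<Rightarrow> ('a \<Rightarrow> real) set \<Rightarrow> real) \<Rightarrow> bool" where
  "W_induces_norm M b \<alpha> S ip \<longleftrightarrow> (\<forall>C\<in>S. W_norm M b \<alpha> C = sqrt (ip C C))"

definition vaguely_converges_on ::
  "'e::topological_space set \<Rightarrow> ('i \<Rightarrow> 'e measure) \<Rightarrow> 'e measure \<Rightarrow> 'i filter \<Rightarrow> bool" where
  "vaguely_converges_on E \<mu> \<nu> F \<longleftrightarrow>
     (\<forall>f :: 'e \<Rightarrow> real.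
        continuous_on E f \<and> (\<exists>K. compact K \<and> K \<subseteq> E \<and> (\<forall>x\<in>E - K. f x = 0)) \<longrightarrow>
        ((\<lambda>s. integral\<^sup>L (\<mu> s) f) \<longlongrightarrow> integral\<^sup>L \<nu> f) F)"

definition punctured_plane :: "(ereal \<times> ereal) set" where
  "punctured_plane = - {(0, 0)}"

definition embed_plane :: "real \<times> real \<Rightarrow> ereal \<times> ereal" where
  "embed_plane = map_prod ereal ereal"

definition scaled_law ::
  "'a measure \<Rightarrow> (real \<Rightarrow> real) \<Rightarrow> ('a \<Rightarrow> real) \<Rightarrow> ('a \<Rightarrow> real) \<Rightarrow> real \<Rightarrow> (ereal \<times> ereal) measure" where
  "scaled_law M b X1 X2 s =
     scale_measure (ennreal (b s))
       (restrict_space (distr M borel (\<lambda>w. embed_plane (X1 w / s, X2 w / s))) punctured_plane)"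

text \<open>
  The punctured extended plane is locally compact and second countable, so a Radon measure on it
  is a Borel measure that is finite on compact sets.
\<close>

definition is_tail_measure ::
  "'a measure \<Rightarrow> (real \<Rightarrow> real) \<Rightarrow> ('a \<Rightarrow> real) \<Rightarrow> ('a \<Rightarrow> real) \<Rightarrow> (ereal \<times> ereal) measure \<Rightarrow> bool" where
  "is_tail_measure M b X1 X2 \<nu> \<longleftrightarrow>
     sets \<nu> = sets (restrict_space borel punctured_plane) \<and>
     (\<forall>K. compact K \<and> K \<subseteq> punctured_plane \<longrightarrow> emeasure \<nu> K < \<infinity>) \<and>
     emeasure \<nu> punctured_plane \<noteq> 0 \<and>
     emeasure \<nu> (punctured_plane - range embed_plane) = 0 \<and>
     vaguely_converges_on punctured_plane (scaled_law M b X1 X2) \<nu> at_top"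

definition jointly_regularly_varying ::
  "'a measure \<Rightarrow> (real \<Rightarrow> real) \<Rightarrow> ('a \<Rightarrow> real) \<Rightarrow> ('a \<Rightarrow> real) \<Rightarrow> bool" where
  "jointly_regularly_varying M b X1 X2 \<longleftrightarrow>
     X1 \<in> borel_measurable M \<and> X2 \<in> borel_measurable M \<and> (\<exists>\<nu>. is_tail_measure M b X1 X2 \<nu>)"

definition tail_measure ::
  "'a measure \<Rightarrow> (real \<Rightarrow> real) \<Rightarrow> ('a \<Rightarrow> real) \<Rightarrow> ('a \<Rightarrow> real) \<Rightarrow> (ereal \<times> ereal) measure" where
  "tail_measure M b X1 X2 = (THE \<nu>. is_tail_measure M b X1 X2 \<nu>)"

text \<open>The norm on \<open>real \<times> real\<close> is the Euclidean one, so \<open>sphere 0 1\<close> is the unit circle.\<close>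

definition is_angular_measure :: "real \<Rightarrow> (ereal \<times> ereal) measure \<Rightarrow> (real \<times> real) measure \<Rightarrow> bool" where
  "is_angular_measure \<alpha> \<nu> H \<longleftrightarrow>
     sets H = sets (restrict_space borel (sphere 0 1)) \<and> finite_measure H \<and>
     (\<forall>r>0. \<forall>B\<in>sets H.
        emeasure \<nu> (embed_plane ` {x. norm x > r \<and> x /\<^sub>R norm x \<in> B}) =
        ennreal (r powr (- \<alpha>)) * emeasure H B)"

definition angular_measure ::
  "'a measure \<Rightarrow> (real \<Rightarrow> real) \<Rightarrow> real \<Rightarrow> ('a \<Rightarrow> real) \<Rightarrow> ('a \<Rightarrow> real) \<Rightarrow> (real \<times> real) measure" where
  "angular_measure M b \<alpha> X1 X2 =
     (if X1 \<in> N_space M b \<and> X2 \<in> N_space M b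
      then null_measure (restrict_space borel (sphere 0 1))
      else THE H. is_angular_measure \<alpha> (tail_measure M b X1 X2) H)"

definition tail_pairwise_dependence ::
  "'a measure \<Rightarrow> (real \<Rightarrow> real) \<Rightarrow> real \<Rightarrow> ('a \<Rightarrow> real) \<Rightarrow> ('a \<Rightarrow> real) \<Rightarrow> real" where
  "tail_pairwise_dependence M b \<alpha> X1 X2 =
     (\<integral>\<omega>. sgn (fst \<omega>) * sgn (snd \<omega>) * \<bar>fst \<omega>\<bar> powr (\<alpha> / 2) * \<bar>snd \<omega>\<bar> powr (\<alpha> / 2)
        \<partial>angular_measure M b \<alpha> X1 X2)"

end

theory Submission
  imports Defs
begin

text \<open>
  Write \<open>q(X) = lim b(s) P(|X| > s)\<close> for the squared norm. A tail measure lives on the real plane, is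
  determined by test functions with compact support off the origin and is hence homogeneous of
  degree \<open>-2\<close>. Sandwiching the indicator of \<open>|a x\<^sub>1 + c x\<^sub>2| > 1\<close> between such test functions (escape of mass
  to infinity being controlled by the tails of \<open>X\<^sub>1\<close> and \<open>X\<^sub>2\<close>) shows that \<open>q(a X\<^sub>1 + c X\<^sub>2)\<close> is the tail
  measure of that region, and polar coordinates turn this into
  \<open>q(a X\<^sub>1 + c X\<^sub>2) = \<integral>(a \<omega>\<^sub>1 + c \<omega>\<^sub>2)\<^sup>2 dH(\<omega>)\<close>. So \<open>q\<close> is a quadratic form on every pair, which gives the
  parallelogram law on \<open>S\<close>, and the polar form of \<open>q\<close> is \<open>\<integral>\<omega>\<^sub>1 \<omega>\<^sub>2 dH\<close>.
\<close>

text \<open>Two obstacles shape the proof. \<open>V_space M b\<close> need not be closed under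
  addition, and joint regular variation is assumed for pairs, whereas additivity of an inner product
  involves three elements. The measure theory is therefore done for one pair with arbitrary real
  coefficients \<open>a\<close> and \<open>c\<close>, and the step to three elements is the algebra
  of Jordan and von Neumann: the parallelogram law for pairs makes the polar form additive.
  Homogeneity for real scalars comes directly from the pair formula. The hypothesis moreover speaks
  of one pair of representatives for each two classes. A null perturbation changes neither squared
  norms nor limits of test integrals, so the conclusion reaches all representatives. Existence of
  the inner product is obtained from the polar form, written with class norms. Its value is forced,
  because every inner product inducing the norm is recovered from the norm by polarization.\<close>

lemma filterlim_mult_const_at_top:
  fixes x :: real
  assumes "x > 0"
  shows "filterlim (\<lambda>s. s * x) at_top at_top"
  using assms by (simp add: filterlim_at_top_mult_tendsto_pos[OF tendsto_const _ filterlim_ident] mult.commute)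

section \<open>Regularly varying tails\<close>

locale tail_setup = prob_space M for M :: "'a measure" +
  fixes b :: "real \<Rightarrow> real"
  assumes norm_fun: "normalizing_function b 2"
begin

lemma b_pos: "s > 0 \<Longrightarrow> b s > 0"
  using norm_fun by (auto simp: normalizing_function_def slowly_varying_def)

text \<open>The powers of s cancel in b(s)/b(s x), leaving x^-2 times L(s)/L(s x). This is the one
  use of the limit property of slow variation; later arguments know \<open>b\<close> only through
  this ratio and its positivity.\<close>

lemma b_ratio:
  assumes x: "x > 0"
  shows "((\<lambda>s. b s / b (s * x)) \<longlongrightarrow> 1 / x\<^sup>2) at_top"
proof -
  obtain L where L: "slowly_varying L" "\<And>s. s > 0 \<Longrightarrow> b s = s powr 2 * L s"
    using norm_fun by (auto simp: normalizing_function_def)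
  have Lp: "\<And>s. s > 0 \<Longrightarrow> L s > 0" and lim: "((\<lambda>s. L (s * x) / L s) \<longlongrightarrow> 1) at_top"
    using L(1) x by (auto simp: slowly_varying_def)
  have "((\<lambda>s. inverse (x\<^sup>2 * (L (s * x) / L s))) \<longlongrightarrow> inverse (x\<^sup>2 * 1)) at_top"
    using x by (intro tendsto_intros lim) auto
  moreover have "eventually (\<lambda>s. inverse (x\<^sup>2 * (L (s * x) / L s)) = b s / b (s * x)) at_top"
    using eventually_gt_at_top[of 0]
  proof eventually_elim
    case (elim s)
    then have "s * x > 0" using x by simp
    with elim x Lp[of s] Lp[of "s * x"] show ?case
      by (simp add: L(2) field_simps power2_eq_square powr_numeral)
  qed
  ultimately show ?thesis
    by (auto dest: tendsto_cong simp: divide_inverse)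
qed

text \<open>The limits in \<open>V_space\<close> are indexed by x, but regular variation of
  \<open>b\<close> forces them to have the form l/x^2, so one constant describes a whole tail
  (\<open>right_tailI\<close>). Left tails are treated as right tails of \<open>- X\<close>.\<close>

definition right_tail :: "('a \<Rightarrow> real) \<Rightarrow> real \<Rightarrow> bool" where
  "right_tail X l \<longleftrightarrow> X \<in> borel_measurable M \<and>
     (\<forall>x>0. ((\<lambda>s. b s * prob {w \<in> space M. X w > s * x}) \<longlongrightarrow> l / x\<^sup>2) at_top)"

lemma right_tail_measurable [measurable_dest]: "right_tail X l \<Longrightarrow> X \<in> borel_measurable M"
  by (simp add: right_tail_def)

lemma right_tailD:
  "right_tail X l \<Longrightarrow> x > 0 \<Longrightarrow> ((\<lambda>s. b s * prob {w \<in> space M. X w > s * x}) \<longlongrightarrow> l / x\<^sup>2) at_top"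
  by (simp add: right_tail_def)

text \<open>Substituting s x for s in the limit at level 1 replaces b(s) by b(s x);
  \<open>b_ratio\<close> converts back at the price of the factor 1/x^2.\<close>

lemma right_tailI:
  assumes "X \<in> borel_measurable M"
    and lim: "((\<lambda>s. b s * prob {w \<in> space M. X w > s}) \<longlongrightarrow> l) at_top"
  shows "right_tail X l"
  unfolding right_tail_def
proof (intro conjI allI impI assms(1))
  fix x :: real assume x: "x > 0"
  have "filterlim (\<lambda>s. s * x) at_top at_top"
    by (rule filterlim_mult_const_at_top[OF x])
  from filterlim_compose[OF lim this]
  have "((\<lambda>s. (b s / b (s * x)) * (b (s * x) * prob {w \<in> space M. X w > s * x})) \<longlongrightarrow> 1 / x\<^sup>2 * l) at_top"
    by (intro tendsto_mult b_ratio x)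
  moreover have "eventually (\<lambda>s. (b s / b (s * x)) * (b (s * x) * prob {w \<in> space M. X w > s * x})
      = b s * prob {w \<in> space M. X w > s * x}) at_top"
    using eventually_gt_at_top[of 0]
  proof eventually_elim
    case (elim s)
    then have "b (s * x) > 0" using x by (intro b_pos) simp
    then show ?case by simp
  qed
  ultimately show "((\<lambda>s. b s * prob {w \<in> space M. X w > s * x}) \<longlongrightarrow> l / x\<^sup>2) at_top"
    by (auto dest: tendsto_cong)
qed

lemma right_tail_at_one:
  "right_tail X l \<Longrightarrow> ((\<lambda>s. b s * prob {w \<in> space M. X w > s}) \<longlongrightarrow> l) at_top"
  using right_tailD[of X l 1] by simp

lemma right_tail_unique: "right_tail X l \<Longrightarrow> right_tail X l' \<Longrightarrow> l = l'"
  by (rule tendsto_unique[OF trivial_limit_at_top_linorder right_tail_at_one right_tail_at_one])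

lemma right_tail_nonneg:
  assumes "right_tail X l" shows "l \<ge> 0"
proof (rule tendsto_lowerbound[OF right_tail_at_one[OF assms]])
  show "\<forall>\<^sub>F s in at_top. 0 \<le> b s * prob {w \<in> space M. X w > s}"
    using eventually_gt_at_top[of 0] by eventually_elim (simp add: b_pos less_imp_le)
qed simp

lemma right_tail_zero_mono:
  assumes X: "right_tail X 0" and [measurable]: "Y \<in> borel_measurable M"
    and le: "\<And>w. w \<in> space M \<Longrightarrow> Y w \<le> X w"
  shows "right_tail Y 0"
proof (rule right_tailI)
  show "((\<lambda>s. b s * prob {w \<in> space M. Y w > s}) \<longlongrightarrow> 0) at_top"
  proof (rule tendsto_sandwich[OF _ _ tendsto_const right_tail_at_one[OF X]])
    show "\<forall>\<^sub>F s in at_top. 0 \<le> b s * prob {w \<in> space M. Y w > s}"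
      using eventually_gt_at_top[of 0] by eventually_elim (simp add: b_pos less_imp_le)
    have [measurable]: "X \<in> borel_measurable M" using X by measurable
    show "\<forall>\<^sub>F s in at_top. b s * prob {w \<in> space M. Y w > s} \<le> b s * prob {w \<in> space M. X w > s}"
      using eventually_gt_at_top[of 0]
      by eventually_elim
        (intro mult_left_mono finite_measure_mono; force simp: b_pos less_imp_le dest: le)
  qed
qed simp

text \<open>If the sum exceeds s, one summand exceeds s/2. With positive constants the same union
  bound would give an upper estimate only.\<close>

lemma right_tail_zero_add:
  assumes X: "right_tail X 0" and Y: "right_tail Y 0"
  shows "right_tail (\<lambda>w. X w + Y w) 0"
proof (rule right_tailI)
  have [measurable]: "X \<in> borel_measurable M" "Y \<in> borel_measurable M" using X Y by measurable
  show "(\<lambda>w. X w + Y w) \<in> borel_measurable M" by measurable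
  have "((\<lambda>s. b s * prob {w \<in> space M. X w > s * (1/2)} + b s * prob {w \<in> space M. Y w > s * (1/2)})
      \<longlongrightarrow> 0 / (1/2)\<^sup>2 + 0 / (1/2)\<^sup>2) at_top"
    by (intro tendsto_add right_tailD X Y) auto
  then have lim: "((\<lambda>s. b s * prob {w \<in> space M. X w > s * (1/2)} + b s * prob {w \<in> space M. Y w > s * (1/2)})
      \<longlongrightarrow> 0) at_top" by simp
  show "((\<lambda>s. b s * prob {w \<in> space M. X w + Y w > s}) \<longlongrightarrow> 0) at_top"
  proof (rule tendsto_sandwich[OF _ _ tendsto_const lim])
    show "\<forall>\<^sub>F s in at_top. 0 \<le> b s * prob {w \<in> space M. X w + Y w > s}"
      using eventually_gt_at_top[of 0] by eventually_elim (simp add: b_pos less_imp_le)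
    show "\<forall>\<^sub>F s in at_top. b s * prob {w \<in> space M. X w + Y w > s}
       \<le> b s * prob {w \<in> space M. X w > s * (1/2)} + b s * prob {w \<in> space M. Y w > s * (1/2)}"
      using eventually_gt_at_top[of 0]
    proof eventually_elim
      case (elim s)
      have "prob {w \<in> space M. X w + Y w > s}
          \<le> prob ({w \<in> space M. X w > s * (1/2)} \<union> {w \<in> space M. Y w > s * (1/2)})"
        by (intro finite_measure_mono) auto
      also have "\<dots> \<le> prob {w \<in> space M. X w > s * (1/2)} + prob {w \<in> space M. Y w > s * (1/2)}"
        by (intro measure_Un_le) auto
      finally show ?case
        using b_pos[OF elim] by (simp add: distrib_left[symmetric] mult_left_mono)
    qed
  qed
qed

lemma prob_shift_le:
  fixes X Y :: "'a \<Rightarrow> real"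
  assumes [measurable]: "X \<in> borel_measurable M" "Y \<in> borel_measurable M"
  shows "prob {w \<in> space M. Y w > u + v} \<le> prob {w \<in> space M. X w > u} + prob {w \<in> space M. \<bar>Y w - X w\<bar> > v}"
proof -
  have "prob {w \<in> space M. Y w > u + v} \<le> prob ({w \<in> space M. X w > u} \<union> {w \<in> space M. \<bar>Y w - X w\<bar> > v})"
    by (intro finite_measure_mono) auto
  also have "\<dots> \<le> prob {w \<in> space M. X w > u} + prob {w \<in> space M. \<bar>Y w - X w\<bar> > v}"
    by (intro measure_Un_le) auto
  finally show ?thesis .
qed

text \<open>For small e > 0, Y > s forces X > s(1 - e) or |Y - X| > s e, and X > s(1 + e) forces Y >
  s or |Y - X| > s e. The second alternative has weight 0 in the limit, so limit points lie between
  l/(1 + e)^2 and l/(1 - e)^2, and e tends to 0.\<close>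

lemma right_tail_perturb:
  assumes X: "right_tail X l" and D: "right_tail (\<lambda>w. \<bar>Y w - X w\<bar>) 0"
    and Ym[measurable]: "Y \<in> borel_measurable M"
  shows "right_tail Y l"
proof (rule right_tailI[OF Ym])
  have Xm[measurable]: "X \<in> borel_measurable M" using X by measurable
  let ?P = "\<lambda>s. b s * prob {w \<in> space M. Y w > s}"
  have up: "\<forall>\<^sub>F s in at_top. ?P s < c" if c: "c > l" for c
  proof -
    have "((\<lambda>e. l / (1 - e)\<^sup>2) \<longlongrightarrow> l / (1 - 0)\<^sup>2) (at_right 0)"
      by (intro tendsto_intros) auto
    then have "\<forall>\<^sub>F e in at_right 0. l / (1 - e)\<^sup>2 < c" using c by (auto dest: order_tendstoD)
    moreover have "\<forall>\<^sub>F e in at_right (0::real). e \<in> {0<..<1}"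
      by (rule eventually_at_right_real) simp
    ultimately obtain e where e: "l / (1 - e)\<^sup>2 < c" "0 < e" "e < 1"
      using eventually_happens[OF eventually_conj] by fastforce
    have "((\<lambda>s. b s * prob {w \<in> space M. X w > s * (1 - e)} + b s * prob {w \<in> space M. \<bar>Y w - X w\<bar> > s * e})
       \<longlongrightarrow> l / (1 - e)\<^sup>2 + 0 / e\<^sup>2) at_top"
      using e by (intro tendsto_add right_tailD X D) auto
    then have "\<forall>\<^sub>F s in at_top. b s * prob {w \<in> space M. X w > s * (1 - e)}
        + b s * prob {w \<in> space M. \<bar>Y w - X w\<bar> > s * e} < c"
      using e(1) by (auto dest: order_tendstoD)
    then show ?thesis using eventually_gt_at_top[of 0]
    proof eventually_elim
      case (elim s)
      have "b s * prob {w \<in> space M. Y w > s * (1 - e) + s * e} \<le>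
         b s * (prob {w \<in> space M. X w > s * (1 - e)} + prob {w \<in> space M. \<bar>Y w - X w\<bar> > s * e})"
        using b_pos elim(2) by (intro mult_left_mono prob_shift_le Xm Ym) (auto simp: less_imp_le)
      also have "\<dots> < c" using elim(1) by (simp add: distrib_left)
      finally show ?case by (simp add: algebra_simps)
    qed
  qed
  have lo: "\<forall>\<^sub>F s in at_top. c < ?P s" if c: "c < l" for c
  proof -
    have "((\<lambda>e. l / (1 + e)\<^sup>2) \<longlongrightarrow> l / (1 + 0)\<^sup>2) (at_right 0)"
      by (intro tendsto_intros) auto
    then have "\<forall>\<^sub>F e in at_right 0. l / (1 + e)\<^sup>2 > c" using c by (auto dest: order_tendstoD)
    moreover have "\<forall>\<^sub>F e in at_right (0::real). e \<in> {0<..<1}"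
      by (rule eventually_at_right_real) simp
    ultimately obtain e where e: "l / (1 + e)\<^sup>2 > c" "0 < e"
      using eventually_happens[OF eventually_conj] by fastforce
    have "((\<lambda>s. b s * prob {w \<in> space M. X w > s * (1 + e)} - b s * prob {w \<in> space M. \<bar>Y w - X w\<bar> > s * e})
       \<longlongrightarrow> l / (1 + e)\<^sup>2 - 0 / e\<^sup>2) at_top"
      using e by (intro tendsto_diff right_tailD X D) auto
    then have "\<forall>\<^sub>F s in at_top. b s * prob {w \<in> space M. X w > s * (1 + e)}
        - b s * prob {w \<in> space M. \<bar>Y w - X w\<bar> > s * e} > c"
      using e(1) by (auto dest: order_tendstoD)
    then show ?thesis using eventually_gt_at_top[of 0]
    proof eventually_elim
      case (elim s)
      have "b s * prob {w \<in> space M. X w > s + s * e} \<le>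
         b s * (prob {w \<in> space M. Y w > s} + prob {w \<in> space M. \<bar>X w - Y w\<bar> > s * e})"
        using b_pos elim(2) by (intro mult_left_mono prob_shift_le Xm Ym) (auto simp: less_imp_le)
      with elim(1) show ?case by (simp add: algebra_simps abs_minus_commute)
    qed
  qed
  show "(?P \<longlongrightarrow> l) at_top" by (intro order_tendstoI up lo)
qed

lemma right_tail_abs:
  assumes X: "right_tail X l" and X': "right_tail (\<lambda>w. - X w) l'"
  shows "right_tail (\<lambda>w. \<bar>X w\<bar>) (l + l')"
proof (rule right_tailI)
  have [measurable]: "X \<in> borel_measurable M" using X by measurable
  show "(\<lambda>w. \<bar>X w\<bar>) \<in> borel_measurable M" by measurable
  have "((\<lambda>s. b s * prob {w \<in> space M. X w > s} + b s * prob {w \<in> space M. - X w > s}) \<longlongrightarrow> l + l') at_top"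
    by (intro tendsto_add right_tail_at_one X X')
  moreover have "\<forall>\<^sub>F s in at_top. b s * prob {w \<in> space M. X w > s} + b s * prob {w \<in> space M. - X w > s}
      = b s * prob {w \<in> space M. \<bar>X w\<bar> > s}"
    using eventually_gt_at_top[of 0]
  proof eventually_elim
    case (elim s)
    have "prob {w \<in> space M. X w > s} + prob {w \<in> space M. - X w > s}
      = prob ({w \<in> space M. X w > s} \<union> {w \<in> space M. - X w > s})"
      using elim by (intro finite_measure_Union[symmetric]) auto
    also have "{w \<in> space M. X w > s} \<union> {w \<in> space M. - X w > s} = {w \<in> space M. \<bar>X w\<bar> > s}"
      by auto
    finally show ?case by (simp add: distrib_left[symmetric])
  qed
  ultimately show "((\<lambda>s. b s * prob {w \<in> space M. \<bar>X w\<bar> > s}) \<longlongrightarrow> l + l') at_top"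
    by (auto dest: tendsto_cong)
qed

lemma right_tail_scale:
  assumes X: "right_tail X l" and a: "a > 0"
  shows "right_tail (\<lambda>w. a * X w) (a\<^sup>2 * l)"
proof (rule right_tailI)
  have [measurable]: "X \<in> borel_measurable M" using X by measurable
  show "(\<lambda>w. a * X w) \<in> borel_measurable M" by measurable
  have "{w \<in> space M. X w > s * (1 / a)} = {w \<in> space M. a * X w > s}" for s
    using a by (auto simp: field_simps)
  then show "((\<lambda>s. b s * prob {w \<in> space M. a * X w > s}) \<longlongrightarrow> a\<^sup>2 * l) at_top"
    using right_tailD[OF X, of "1 / a"] a by (simp add: power_one_over field_simps)
qed

lemma right_tail_zero: "right_tail (\<lambda>w. 0) 0"
proof (rule right_tailI)
  have "\<forall>\<^sub>F s in at_top. b s * prob {w \<in> space M. 0 > s} = 0"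
    using eventually_gt_at_top[of 0] by eventually_elim auto
  then show "((\<lambda>s. b s * prob {w \<in> space M. 0 > s}) \<longlongrightarrow> 0) at_top"
    by (rule tendsto_eventually)
qed simp

section \<open>\<open>V_space\<close> and \<open>N_space\<close> expressed by one-sided tail
  constants\<close>

lemma V_space_iff: "X \<in> V_space M b \<longleftrightarrow> (\<exists>l. right_tail X l) \<and> (\<exists>l. right_tail (\<lambda>w. - X w) l)"
proof -
  have eq: "{w \<in> space M. X w < - (s * x)} = {w \<in> space M. - X w > s * x}" for s x by auto
  show ?thesis
  proof
    assume V: "X \<in> V_space M b"
    then have [measurable]: "X \<in> borel_measurable M" by (simp add: V_space_def)
    have "(\<exists>l. ((\<lambda>s. b s * prob {w \<in> space M. X w > s * x}) \<longlongrightarrow> l) at_top) \<and>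
        (\<exists>l. ((\<lambda>s. b s * prob {w \<in> space M. - X w > s * x}) \<longlongrightarrow> l) at_top)" if "x > 0" for x
      using V that by (simp add: V_space_def eq)
    from this[of 1] obtain l l' where "((\<lambda>s. b s * prob {w \<in> space M. X w > s}) \<longlongrightarrow> l) at_top"
        "((\<lambda>s. b s * prob {w \<in> space M. - X w > s}) \<longlongrightarrow> l') at_top"
      by auto
    then have "right_tail X l" "right_tail (\<lambda>w. - X w) l'" by (simp_all add: right_tailI)
    then show "(\<exists>l. right_tail X l) \<and> (\<exists>l. right_tail (\<lambda>w. - X w) l)" by blast
  next
    assume "(\<exists>l. right_tail X l) \<and> (\<exists>l. right_tail (\<lambda>w. - X w) l)"
    then obtain l l' where l: "right_tail X l" "right_tail (\<lambda>w. - X w) l'" by blast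
    have "((\<lambda>s. b s * prob {w \<in> space M. X w < - (s * x)}) \<longlongrightarrow> l' / x\<^sup>2) at_top" if "x > 0" for x
      using right_tailD[OF l(2) that] by (simp only: eq)
    then show "X \<in> V_space M b"
      using l(1) unfolding V_space_def right_tail_def by blast
  qed
qed

lemma N_space_iff': "X \<in> N_space M b \<longleftrightarrow> right_tail X 0 \<and> right_tail (\<lambda>w. - X w) 0"
proof -
  have eq: "{w \<in> space M. X w < - (s * x)} = {w \<in> space M. - X w > s * x}" for s x by auto
  have iff: "X \<in> N_space M b \<longleftrightarrow> X \<in> V_space M b \<and>
      (\<forall>x>0. ((\<lambda>s. b s * prob {w \<in> space M. X w > s * x}) \<longlongrightarrow> 0) at_top) \<and>
      (\<forall>x>0. ((\<lambda>s. b s * prob {w \<in> space M. - X w > s * x}) \<longlongrightarrow> 0) at_top)"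
    unfolding N_space_def mem_Collect_eq eq by blast
  show ?thesis
  proof
    assume "X \<in> N_space M b"
    moreover from this have "X \<in> borel_measurable M" by (simp add: N_space_def V_space_def)
    ultimately show "right_tail X 0 \<and> right_tail (\<lambda>w. - X w) 0"
      by (simp add: iff right_tail_def)
  next
    assume X: "right_tail X 0 \<and> right_tail (\<lambda>w. - X w) 0"
    then have "X \<in> V_space M b" by (auto simp: V_space_iff)
    with X show "X \<in> N_space M b" by (simp add: iff right_tail_def)
  qed
qed

text \<open>\<open>X\<close> and \<open>- X\<close> are dominated by |X|, and conversely the
  constants of the two disjoint tails add up to that of |X|. The two-sided form reduces closure of
  null variables under sums to the triangle inequality.\<close>

lemma N_space_iff: "X \<in> N_space M b \<longleftrightarrow> X \<in> borel_measurable M \<and> right_tail (\<lambda>w. \<bar>X w\<bar>) 0"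
proof
  assume "X \<in> N_space M b"
  then show "X \<in> borel_measurable M \<and> right_tail (\<lambda>w. \<bar>X w\<bar>) 0"
    using right_tail_abs[of X 0 0] by (auto simp: N_space_iff' right_tail_def)
next
  assume "X \<in> borel_measurable M \<and> right_tail (\<lambda>w. \<bar>X w\<bar>) 0"
  then show "X \<in> N_space M b"
    unfolding N_space_iff' by (auto intro!: right_tail_zero_mono[of "\<lambda>w. \<bar>X w\<bar>"])
qed

lemma N_subset_V: "N_space M b \<subseteq> V_space M b"
  by (auto simp: N_space_def)

lemma N_space_zero: "(\<lambda>w. 0) \<in> N_space M b"
  using right_tail_zero by (simp add: N_space_iff)

lemma N_space_add:
  assumes "X \<in> N_space M b" "Y \<in> N_space M b" shows "(\<lambda>w. X w + Y w) \<in> N_space M b"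
proof -
  have [measurable]: "X \<in> borel_measurable M" "Y \<in> borel_measurable M"
    and "right_tail (\<lambda>w. \<bar>X w\<bar>) 0" "right_tail (\<lambda>w. \<bar>Y w\<bar>) 0"
    using assms by (simp_all only: N_space_iff)
  then have "right_tail (\<lambda>w. \<bar>X w\<bar> + \<bar>Y w\<bar>) 0"
    by (intro right_tail_zero_add)
  moreover have "(\<lambda>w. \<bar>X w + Y w\<bar>) \<in> borel_measurable M" by measurable
  ultimately have "right_tail (\<lambda>w. \<bar>X w + Y w\<bar>) 0"
    by (rule right_tail_zero_mono) (rule abs_triangle_ineq)
  then show ?thesis
    by (simp add: N_space_iff)
qed

lemma V_space_scale:
  assumes X: "X \<in> V_space M b" shows "(\<lambda>w. a * X w) \<in> V_space M b"
proof -
  consider "a = 0" | "a > 0" | "a < 0" by linarith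
  then show ?thesis
  proof cases
    case 1 then show ?thesis using N_space_zero N_subset_V by auto
  next
    case 2
    obtain l l' where "right_tail X l" "right_tail (\<lambda>w. - X w) l'" using X by (auto simp: V_space_iff)
    from this[THEN right_tail_scale[OF _ 2]] show ?thesis
      unfolding V_space_iff by (auto simp only: mult_minus_right)
  next
    \<comment> \<open>A negative factor exchanges the tails: the right tail of \<open>a * X\<close>
      is that of \<open>- X\<close> scaled by \<open>- a\<close>.\<close>
    case 3
    obtain l l' where "right_tail X l" "right_tail (\<lambda>w. - X w) l'" using X by (auto simp: V_space_iff)
    moreover have "- a > 0" using 3 by simp
    ultimately have "right_tail (\<lambda>w. - a * - X w) ((- a)\<^sup>2 * l')" "right_tail (\<lambda>w. - a * X w) ((- a)\<^sup>2 * l)"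
      using right_tail_scale by blast+
    then show ?thesis
      unfolding V_space_iff by (auto simp only: minus_mult_minus minus_mult_left)
  qed
qed

lemma N_space_scale:
  assumes X: "X \<in> N_space M b" shows "(\<lambda>w. a * X w) \<in> N_space M b"
proof (cases "a = 0")
  case True then show ?thesis using N_space_zero by auto
next
  case False
  then show ?thesis
    using X right_tail_scale[of "\<lambda>w. \<bar>X w\<bar>" 0 "\<bar>a\<bar>"] by (auto simp: N_space_iff abs_mult)
qed

text \<open>Membership in \<open>V_space\<close> survives null perturbations. This later allows one
  sum of representatives to be replaced by another, although \<open>V_space\<close> need not be
  closed under addition.\<close>

lemma V_space_perturb:
  assumes X: "X \<in> V_space M b" and Y: "Y \<in> borel_measurable M" and D: "(\<lambda>w. X w - Y w) \<in> N_space M b"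
  shows "Y \<in> V_space M b"
proof -
  have D1: "right_tail (\<lambda>w. \<bar>Y w - X w\<bar>) 0" and D2: "right_tail (\<lambda>w. \<bar>- Y w - - X w\<bar>) 0"
    using D by (simp_all add: N_space_iff abs_minus_commute)
  obtain l l' where l: "right_tail X l" "right_tail (\<lambda>w. - X w) l'"
    using X by (auto simp: V_space_iff)
  have "right_tail Y l"
    by (rule right_tail_perturb[OF l(1) D1 Y])
  moreover have "right_tail (\<lambda>w. - Y w) l'"
    by (rule right_tail_perturb[OF l(2) D2 borel_measurable_uminus[OF Y]])
  ultimately show ?thesis by (auto simp: V_space_iff)
qed

section \<open>The squared norm \<open>q\<close> as the constant of the two-sided tail\<close>

definition tail_const :: "('a \<Rightarrow> real) \<Rightarrow> real" where
  "tail_const X = (THE l. right_tail (\<lambda>w. \<bar>X w\<bar>) l)"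

lemma tail_const_eq: "right_tail (\<lambda>w. \<bar>X w\<bar>) l \<Longrightarrow> tail_const X = l"
  unfolding tail_const_def by (rule the_equality) (auto dest: right_tail_unique)

lemma right_tail_tail_const:
  assumes "X \<in> V_space M b" shows "right_tail (\<lambda>w. \<bar>X w\<bar>) (tail_const X)"
proof -
  obtain l l' where "right_tail X l" "right_tail (\<lambda>w. - X w) l'"
    using assms by (auto simp: V_space_iff)
  then have "right_tail (\<lambda>w. \<bar>X w\<bar>) (l + l')" by (rule right_tail_abs)
  with tail_const_eq[OF this] show ?thesis by simp
qed

lemma tail_const_nonneg: "X \<in> V_space M b \<Longrightarrow> tail_const X \<ge> 0"
  using right_tail_tail_const right_tail_nonneg by blast

lemma V_norm_eq:
  assumes "X \<in> V_space M b" shows "V_norm M b 2 X = sqrt (tail_const X)"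
proof -
  have "Lim at_top (\<lambda>s. b s * prob {w \<in> space M. \<bar>X w\<bar> > s}) = tail_const X"
    using right_tail_at_one[OF right_tail_tail_const[OF assms]] by (intro tendsto_Lim) auto
  then show ?thesis
    using tail_const_nonneg[OF assms] by (simp add: V_norm_def powr_half_sqrt)
qed

text \<open>Since | |Y| - |X| | is at most |Y - X|, the two-sided tail of Y is a null perturbation
  of that of X. Hence the norm is well defined on classes.\<close>

lemma tail_const_perturb:
  assumes X: "X \<in> V_space M b" and Y: "Y \<in> borel_measurable M" and D: "(\<lambda>w. X w - Y w) \<in> N_space M b"
  shows "tail_const Y = tail_const X"
proof (rule tail_const_eq, rule right_tail_perturb[OF right_tail_tail_const[OF X]])
  have [measurable]: "X \<in> borel_measurable M" using X by (simp add: V_space_def)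
  have "right_tail (\<lambda>w. \<bar>X w - Y w\<bar>) 0" using D by (simp add: N_space_iff)
  then show "right_tail (\<lambda>w. \<bar>\<bar>Y w\<bar> - \<bar>X w\<bar>\<bar>) 0"
    using Y by (rule_tac right_tail_zero_mono) (auto intro: abs_triangle_ineq3 simp: abs_minus_commute)
qed (use Y in simp)

lemma tail_const_zero_iff: "X \<in> V_space M b \<Longrightarrow> tail_const X = 0 \<longleftrightarrow> X \<in> N_space M b"
  using right_tail_tail_const[of X] tail_const_eq[of X 0] by (auto simp: N_space_iff V_space_def)

end

declare split_paired_All [simp del] split_paired_Ex [simp del]

section \<open>Test functions on the extended plane\<close>

lemma integral_scale_measure:
  fixes f :: "'b \<Rightarrow> real"
  assumes c: "c \<ge> 0" and f: "f \<in> borel_measurable M"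
  shows "integral\<^sup>L (scale_measure (ennreal c) M) f = c * integral\<^sup>L M f"
proof -
  have "scale_measure (ennreal c) M = density M (\<lambda>_. ennreal c)"
    by (rule measure_eqI) (auto simp: emeasure_density_const)
  then show ?thesis
    using assms by (simp add: integral_density)
qed

lemma compact_UNIV_ereal: "compact (UNIV :: ereal set)"
proof -
  have "seq_compact (UNIV :: ereal set)"
    unfolding seq_compact_def by (meson UNIV_I compact_complete_linorder)
  then show ?thesis by (simp add: seq_compact_eq_compact)
qed

lemma compact_closed_ereal_plane:
  fixes K :: "(ereal \<times> ereal) set"
  assumes "closed K" shows "compact K"
  using compact_Int_closed[OF compact_Times[OF compact_UNIV_ereal compact_UNIV_ereal] assms]
  by simp

text \<open>Even for infinite \<open>z\<close> the sum of \<open>z\<close> and a null difference is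
  defined, so finite points at vanishing distance have the same limit in the extended line.\<close>

lemma ereal_tendsto_shift:
  fixes x y :: "nat \<Rightarrow> real"
  assumes x: "(\<lambda>n. ereal (x n)) \<longlonglongrightarrow> z" and d: "(\<lambda>n. y n - x n) \<longlonglongrightarrow> 0"
  shows "(\<lambda>n. ereal (y n)) \<longlonglongrightarrow> z"
proof -
  have "(\<lambda>n. ereal (y n - x n)) \<longlonglongrightarrow> ereal 0"
    using d by (intro tendsto_intros)
  then have "(\<lambda>n. ereal (x n) + ereal (y n - x n)) \<longlonglongrightarrow> z + ereal 0"
    by (intro tendsto_add_ereal_general x) auto
  then show ?thesis by simp
qed

lemma embed_plane_eq: "embed_plane x = (ereal (fst x), ereal (snd x))"
  by (cases x) (simp add: embed_plane_def)

lemma continuous_embed_plane: "continuous_on A embed_plane"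
  unfolding embed_plane_eq[abs_def] by (intro continuous_intros)

lemma measurable_embed_plane [measurable]: "embed_plane \<in> borel \<rightarrow>\<^sub>M borel"
  by (rule borel_measurable_continuous_onI) (rule continuous_embed_plane)

text \<open>Two planar sequences whose distance tends to 0 have, along a subsequence, a common limit
  in the compact square [-infinity, infinity]^2, where \<open>f\<close> is continuous. The pathwise
  comparison of (X1, X2)/s with (Y1, Y2)/s rests on this.\<close>

lemma uniformly_continuous_embed_plane:
  fixes f :: "ereal \<times> ereal \<Rightarrow> real"
  assumes f: "continuous_on UNIV f"
  shows "uniformly_continuous_on UNIV (\<lambda>x. f (embed_plane x))"
proof (rule ccontr)
  assume "\<not> ?thesis"
  then obtain e where e: "e > 0"
    "\<And>d. d > 0 \<Longrightarrow> \<exists>x y. dist y x < d \<and> \<not> dist (f (embed_plane y)) (f (embed_plane x)) < e"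
    unfolding uniformly_continuous_on_def by blast
  have "\<exists>x y. dist y x < inverse (real (Suc n)) \<and> \<not> dist (f (embed_plane y)) (f (embed_plane x)) < e" for n
    by (rule e(2)) simp
  then obtain x y where xy: "\<And>n. dist (y n) (x n) < inverse (real (Suc n))"
    "\<And>n. \<not> dist (f (embed_plane (y n))) (f (embed_plane (x n))) < e"
    by metis
  have d: "(\<lambda>n. dist (y n) (x n)) \<longlonglongrightarrow> 0"
    by (rule tendsto_sandwich[OF _ _ tendsto_const LIMSEQ_inverse_real_of_nat])
      (use xy(1) in \<open>auto intro!: eventuallyI less_imp_le\<close>)
  \<comment> \<open>Compactness is applied one coordinate at a time; \<open>r2\<close> refines
    \<open>r1\<close> so that both coordinates converge.\<close>
  obtain l1 r1 where r1: "strict_mono r1" "((\<lambda>n. ereal (fst (x n))) \<circ> r1) \<longlonglongrightarrow> l1"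
    using compact_complete_linorder by blast
  obtain l2 r2 where r2: "strict_mono r2" "((\<lambda>n. ereal (snd (x (r1 n)))) \<circ> r2) \<longlonglongrightarrow> l2"
    using compact_complete_linorder by blast
  define r where "r = r1 \<circ> r2"
  have r: "strict_mono r" unfolding r_def by (intro strict_mono_o r1 r2)
  have x1: "(\<lambda>n. ereal (fst (x (r n)))) \<longlonglongrightarrow> l1"
    using LIMSEQ_subseq_LIMSEQ[OF r1(2) r2(1)] by (simp add: r_def o_def)
  have x2: "(\<lambda>n. ereal (snd (x (r n)))) \<longlonglongrightarrow> l2"
    using r2(2) by (simp add: r_def o_def)
  have dr: "(\<lambda>n. dist (y (r n)) (x (r n))) \<longlonglongrightarrow> 0"
    using LIMSEQ_subseq_LIMSEQ[OF d r] by (simp add: o_def)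
  have "(\<lambda>n. y (r n) - x (r n)) \<longlonglongrightarrow> 0"
    using dr by (simp add: dist_norm tendsto_norm_zero_iff)
  from tendsto_fst[OF this] tendsto_snd[OF this]
  have "(\<lambda>n. fst (y (r n)) - fst (x (r n))) \<longlonglongrightarrow> 0" "(\<lambda>n. snd (y (r n)) - snd (x (r n))) \<longlonglongrightarrow> 0"
    by simp_all
  then have y: "(\<lambda>n. embed_plane (y (r n))) \<longlonglongrightarrow> (l1, l2)"
    unfolding embed_plane_eq by (intro tendsto_Pair ereal_tendsto_shift[OF x1] ereal_tendsto_shift[OF x2])
  have x: "(\<lambda>n. embed_plane (x (r n))) \<longlonglongrightarrow> (l1, l2)"
    unfolding embed_plane_eq by (intro tendsto_Pair x1 x2)
  have cont: "isCont f (l1, l2)" using f by (simp add: continuous_on_eq_continuous_at)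
  have "(\<lambda>n. dist (f (embed_plane (y (r n)))) (f (embed_plane (x (r n))))) \<longlonglongrightarrow> dist (f (l1, l2)) (f (l1, l2))"
    by (intro tendsto_dist isCont_tendsto_compose[OF cont] x y)
  then have "(\<lambda>n. dist (f (embed_plane (y (r n)))) (f (embed_plane (x (r n))))) \<longlonglongrightarrow> 0" by simp
  from order_tendstoD(2)[OF this e(1)] show False
    using xy(2) by (auto simp: eventually_sequentially)
qed

lemma punctured_plane_open: "open punctured_plane"
  unfolding punctured_plane_def by auto

text \<open>Vague convergence does not see the value of a test function at the origin, which is
  therefore reset to 0; the result is continuous on the compact space \<open>[-\<infinity>, \<infinity>]\<^sup>2\<close>.\<close>

lemma test_function_props:
  fixes f :: "ereal \<times> ereal \<Rightarrow> real"
  assumes f: "continuous_on punctured_plane f" and K: "compact K" "K \<subseteq> punctured_plane"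
    and fK: "\<forall>x\<in>punctured_plane - K. f x = 0"
  defines "g \<equiv> \<lambda>x. if x \<in> punctured_plane then f x else 0"
  shows "continuous_on UNIV g" "\<exists>B. \<forall>x. \<bar>g x\<bar> \<le> B" "\<exists>e>0. \<forall>x. norm x < e \<longrightarrow> g (embed_plane x) = 0"
proof -
  have K': "open (- K)" using K(1) compact_imp_closed by blast
  have gK: "\<And>x. x \<in> - K \<Longrightarrow> g x = 0" using fK by (auto simp: g_def)
  \<comment> \<open>Both sets are open and cover the square, because K avoids the origin; on
    \<open>- K\<close> the function \<open>g\<close> is constantly 0.\<close>
  have "continuous_on (punctured_plane \<union> - K) g"
  proof (rule continuous_on_open_Un[OF punctured_plane_open K'])
    show "continuous_on punctured_plane g"
      using f by (rule continuous_on_eq) (simp add: g_def)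
    show "continuous_on (- K) g"
      by (rule continuous_on_eq[OF continuous_on_const[of _ 0]]) (simp add: gK)
  qed
  moreover have "punctured_plane \<union> - K = UNIV" using K by auto
  ultimately show c: "continuous_on UNIV g" by simp
  have "compact (UNIV :: (ereal \<times> ereal) set)" by (rule compact_closed_ereal_plane) simp
  then have "bounded (range g)" using c compact_continuous_image compact_imp_bounded by blast
  then show "\<exists>B. \<forall>x. \<bar>g x\<bar> \<le> B" by (auto simp: bounded_iff)
  have "open (embed_plane -` (- K))"
    by (rule open_vimage[OF K' continuous_embed_plane])
  moreover have "embed_plane 0 = (0, 0)" by (simp add: embed_plane_eq)
  then have "0 \<in> embed_plane -` (- K)"
    using K(2) by (auto simp: punctured_plane_def)
  ultimately obtain e where e: "e > 0" "ball 0 e \<subseteq> embed_plane -` (- K)"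
    unfolding open_contains_ball by blast
  have "g (embed_plane x) = 0" if "norm x < e" for x
  proof (rule gK)
    have "x \<in> ball 0 e" using that by simp
    with e(2) show "embed_plane x \<in> - K" by blast
  qed
  with e(1) show "\<exists>e>0. \<forall>x. norm x < e \<longrightarrow> g (embed_plane x) = 0" by blast
qed

text \<open>The continuous functions with compact support in the real plane without the origin.
  Unlike general test functions of vague convergence on the extended plane they also vanish near
  infinity; they still determine a tail measure, which gives no mass to infinity.\<close>

definition Cc_punctured :: "(real \<times> real \<Rightarrow> real) set" where
  "Cc_punctured = {F. continuous_on UNIV F \<and> (\<exists>e>0. \<forall>x. norm x < e \<longrightarrow> F x = 0) \<and>
     (\<exists>R. \<forall>x. norm x > R \<longrightarrow> F x = 0)}"

lemma Cc_punctured_measurable: "F \<in> Cc_punctured \<Longrightarrow> F \<in> borel_measurable borel"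
  by (simp add: Cc_punctured_def borel_measurable_continuous_onI)

lemma Cc_punctured_bounded:
  assumes "F \<in> Cc_punctured" shows "\<exists>B. \<forall>x. \<bar>F x\<bar> \<le> B"
proof -
  obtain R where F: "continuous_on UNIV F" "\<forall>x. norm x > R \<longrightarrow> F x = 0"
    using assms by (auto simp: Cc_punctured_def)
  have "bounded (F ` cball 0 R)"
    using F(1) by (intro compact_imp_bounded compact_continuous_image) (auto intro: continuous_on_subset)
  then obtain B where B': "\<forall>y\<in>F ` cball 0 R. norm y \<le> B" unfolding bounded_iff by blast
  have B: "\<bar>F x\<bar> \<le> B" if "norm x \<le> R" for x
  proof -
    have "F x \<in> F ` cball 0 R" using that by (intro imageI) simp
    with B' show ?thesis by auto
  qed
  have "\<bar>F x\<bar> \<le> max B 0" for x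
    using B[of x] F(2) by (cases "norm x \<le> R") auto
  then show ?thesis by blast
qed

text \<open>Clamping the coordinates to \<open>[-R, R]\<close> extends a test function to the points at infinity.\<close>

lemma Cc_punctured_extend:
  assumes F: "F \<in> Cc_punctured"
  obtains f K where "continuous_on UNIV f" "compact K" "K \<subseteq> punctured_plane"
    "\<forall>x\<in>punctured_plane - K. f x = 0" "\<And>x. f (embed_plane x) = F x" "f (0, 0) = 0"
proof -
  obtain e R0 where Fc: "continuous_on UNIV F" and e: "e > 0" "\<And>x. norm x < e \<Longrightarrow> F x = 0"
    and R0: "\<And>x. norm x > R0 \<Longrightarrow> F x = 0"
    using F by (auto simp: Cc_punctured_def)
  \<comment> \<open>R > R0 makes clamping harmless: if it moves a point, both the point and its
    image have norm above R0, where F is 0. R > e keeps the small square cut out of \<open>K\<close>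
    below fixed by the clamp.\<close>
  define R where "R = \<bar>R0\<bar> + e + 1"
  have R: "R > 0" "R > R0" "R > e" using e(1) by (auto simp: R_def)
  define cl where "cl z = real_of_ereal (max (ereal (- R)) (min (ereal R) z))" for z
  have fin: "max (ereal (- R)) (min (ereal R) z) \<noteq> \<infinity>" "max (ereal (- R)) (min (ereal R) z) \<noteq> - \<infinity>" for z
    using R by (cases z; simp add: max_def min_def)+
  have cl: "continuous_on UNIV cl"
    unfolding cl_def
    by (rule continuous_on_compose2[OF continuous_on_real]) (use fin in \<open>auto intro!: continuous_intros\<close>)
  have cl_le: "cl (ereal t) = t" if "\<bar>t\<bar> \<le> R" for t
    using that R by (auto simp: cl_def max_def min_def)
  have cl_big: "\<bar>cl (ereal t)\<bar> = R" if "\<bar>t\<bar> > R" for t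
    using that R by (auto simp: cl_def max_def min_def)
  have cl_small: "\<bar>cl z\<bar> < e / 2" if "z \<in> {ereal (- (e/2))<..<ereal (e/2)}" for z
    using that R e by (cases z) (auto simp: cl_def max_def min_def)
  define f where "f x = F (cl (fst x), cl (snd x))" for x
  \<comment> \<open>The half side e/2 puts the removed square inside the ball of radius e, the norm
    being at most the sum of the moduli of the coordinates.\<close>
  define K where "K = - ({ereal (- (e/2))<..<ereal (e/2)} \<times> {ereal (- (e/2))<..<ereal (e/2)})"
  have zero: "f x = 0" if "x \<notin> K" for x
  proof -
    have "fst x \<in> {ereal (- (e/2))<..<ereal (e/2)}" "snd x \<in> {ereal (- (e/2))<..<ereal (e/2)}"
      using that by (auto simp: K_def)
    then have "\<bar>cl (fst x)\<bar> < e / 2" "\<bar>cl (snd x)\<bar> < e / 2"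
      by (simp_all only: cl_small)
    then have "norm (cl (fst x), cl (snd x)) < e"
      using norm_Pair_le[of "cl (fst x)" "cl (snd x)"] by simp
    then show ?thesis unfolding f_def by (rule e(2))
  qed
  have "continuous_on UNIV f"
    unfolding f_def
    by (rule continuous_on_compose2[OF Fc])
      (auto intro!: continuous_intros continuous_on_compose2[OF cl])
  moreover have "compact K"
    unfolding K_def by (intro compact_closed_ereal_plane closed_Compl open_Times) auto
  moreover have 0: "(0, 0) \<notin> K" using e(1) by (auto simp: K_def)
  then have "K \<subseteq> punctured_plane" by (auto simp: punctured_plane_def)
  moreover have "f (embed_plane x) = F x" for x
  proof (cases "\<bar>fst x\<bar> \<le> R \<and> \<bar>snd x\<bar> \<le> R")
    case True
    then show ?thesis by (simp add: f_def embed_plane_eq cl_le)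
  next
    case False
    let ?y = "(cl (fst (embed_plane x)), cl (snd (embed_plane x)))"
    have "norm x \<ge> \<bar>fst x\<bar>" "norm x \<ge> \<bar>snd x\<bar>"
      using norm_fst_le[of "fst x" "snd x"] norm_snd_le[of "snd x" "fst x"] by auto
    then have "norm x > R0" using False R by auto
    moreover have "norm ?y \<ge> R"
      using False norm_fst_le[of "fst ?y" "snd ?y"] norm_snd_le[of "snd ?y" "fst ?y"]
        cl_big[of "fst x"] cl_big[of "snd x"] by (auto simp: embed_plane_eq)
    then have "norm ?y > R0" using R by linarith
    ultimately show ?thesis unfolding f_def by (simp add: R0)
  qed
  ultimately show ?thesis using that zero[OF 0] zero by blast
qed

section \<open>From the extended plane to the real plane\<close>

definition planar :: "(ereal \<times> ereal) measure \<Rightarrow> (real \<times> real) measure" where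
  "planar \<nu> = distr \<nu> borel (\<lambda>x. (real_of_ereal (fst x), real_of_ereal (snd x)))"

lemma sets_planar [simp, measurable_cong]: "sets (planar \<nu>) = sets borel"
  by (simp add: planar_def)

lemma space_planar [simp]: "space (planar \<nu>) = UNIV"
  by (simp add: planar_def)

lemma range_embed_plane: "range embed_plane = {x. \<bar>fst x\<bar> \<noteq> \<infinity> \<and> \<bar>snd x\<bar> \<noteq> \<infinity>}"
proof (intro set_eqI iffI)
  fix x :: "ereal \<times> ereal" assume "x \<in> {x. \<bar>fst x\<bar> \<noteq> \<infinity> \<and> \<bar>snd x\<bar> \<noteq> \<infinity>}"
  then have "x = embed_plane (real_of_ereal (fst x), real_of_ereal (snd x))"
    by (auto simp: embed_plane_eq ereal_real prod_eq_iff)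
  then show "x \<in> range embed_plane" by blast
qed (auto simp: embed_plane_eq)

lemma embed_plane_measurable_range: "range embed_plane \<in> sets borel"
proof -
  have "range embed_plane = (- {\<infinity>, - \<infinity>}) \<times> (- {\<infinity>, - \<infinity>})"
    unfolding range_embed_plane by (auto simp: abs_ereal_ge0 ereal_infinity_cases)
  also have "open \<dots>" by (intro open_Times open_Compl) auto
  finally show ?thesis by simp
qed

locale plane_measure =
  fixes \<nu> :: "(ereal \<times> ereal) measure"
  assumes sets_nu: "sets \<nu> = sets (restrict_space borel punctured_plane)"
    and finite_compact: "compact K \<Longrightarrow> K \<subseteq> punctured_plane \<Longrightarrow> emeasure \<nu> K < \<infinity>"
    and null_infinity: "emeasure \<nu> (punctured_plane - range embed_plane) = 0"
begin

lemma space_nu: "space \<nu> = punctured_plane"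
  using sets_eq_imp_space_eq[OF sets_nu] by (simp add: space_restrict_space)

lemma in_sets_nu: "A \<in> sets \<nu> \<longleftrightarrow> A \<subseteq> punctured_plane \<and> A \<in> sets borel"
  unfolding sets_nu using punctured_plane_open
  by (subst sets_restrict_space_iff) auto

lemma measurable_borel_nu: "f \<in> borel_measurable borel \<Longrightarrow> f \<in> borel_measurable \<nu>"
  unfolding measurable_cong_sets[OF sets_nu refl] by (rule measurable_restrict_space1)

lemma real_part_measurable:
  "(\<lambda>x. (real_of_ereal (fst x), real_of_ereal (snd x))) \<in> \<nu> \<rightarrow>\<^sub>M borel"
proof -
  have "(\<lambda>x. (real_of_ereal (fst x), real_of_ereal (snd x))) \<in> (borel \<Otimes>\<^sub>M borel) \<rightarrow>\<^sub>M (borel \<Otimes>\<^sub>M borel)"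
    by measurable
  then show ?thesis by (intro measurable_borel_nu) (simp add: borel_prod)
qed

lemma AE_real: "AE x in \<nu>. x \<in> range embed_plane"
proof (rule AE_I)
  show "{x \<in> space \<nu>. x \<notin> range embed_plane} \<subseteq> punctured_plane - range embed_plane"
    by (auto simp: space_nu)
  show "punctured_plane - range embed_plane \<in> sets \<nu>"
    unfolding in_sets_nu using punctured_plane_open embed_plane_measurable_range by auto
qed (rule null_infinity)

text \<open>\<open>planar\<close> forgets nothing: the points that it misplaces have an infinite
  coordinate and form a null set. So \<nu> can be recovered from its image on the real
  plane.\<close>

lemma emeasure_nu_planar:
  assumes A: "A \<in> sets \<nu>"
  shows "emeasure \<nu> A = emeasure (planar \<nu>) (embed_plane -` A)"
proof -
  have "embed_plane -` A \<inter> space borel \<in> sets borel"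
    using A by (intro measurable_sets[OF measurable_embed_plane]) (auto simp: in_sets_nu)
  then have "emeasure (planar \<nu>) (embed_plane -` A) =
     emeasure \<nu> ((\<lambda>x. (real_of_ereal (fst x), real_of_ereal (snd x))) -` (embed_plane -` A) \<inter> space \<nu>)"
    unfolding planar_def by (intro emeasure_distr real_part_measurable) auto
  also have "\<dots> = emeasure \<nu> A"
  proof (rule emeasure_eq_AE)
    show "AE x in \<nu>. x \<in> (\<lambda>x. (real_of_ereal (fst x), real_of_ereal (snd x))) -` (embed_plane -` A) \<inter> space \<nu> \<longleftrightarrow> x \<in> A"
      using AE_real AE_space
    proof eventually_elim
      case (elim x)
      then obtain y where "x = embed_plane y" by blast
      with elim show ?case by (simp add: embed_plane_eq)
    qed
    show "(\<lambda>x. (real_of_ereal (fst x), real_of_ereal (snd x))) -` embed_plane -` A \<inter> space \<nu> \<in> sets \<nu>"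
      using \<open>embed_plane -` A \<inter> space borel \<in> sets borel\<close>
      by (intro measurable_sets[OF real_part_measurable]) auto
  qed (rule A)
  finally show ?thesis by simp
qed

lemma embed_plane_image_sets:
  assumes A: "A \<in> sets borel" "0 \<notin> A"
  shows "embed_plane ` A \<in> sets \<nu>"
proof -
  have eq: "embed_plane ` A = range embed_plane \<inter> ((\<lambda>x. (real_of_ereal (fst x), real_of_ereal (snd x))) -` A \<inter> space borel)"
    by (auto simp: embed_plane_eq image_iff)
  have "(\<lambda>x. (real_of_ereal (fst x), real_of_ereal (snd x))) \<in> (borel \<Otimes>\<^sub>M borel) \<rightarrow>\<^sub>M (borel \<Otimes>\<^sub>M borel)"
    by measurable
  then have "embed_plane ` A \<in> sets borel"
    unfolding eq using A(1) embed_plane_measurable_range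
    by (intro sets.Int measurable_sets[of _ _ borel]) (auto simp: borel_prod)
  moreover have "embed_plane ` A \<subseteq> punctured_plane"
    using A(2) by (auto simp: punctured_plane_def embed_plane_eq zero_ereal_def zero_prod_def prod_eq_iff)
  ultimately show ?thesis by (simp add: in_sets_nu)
qed

lemma emeasure_planar:
  assumes A: "A \<in> sets borel" "0 \<notin> A"
  shows "emeasure \<nu> (embed_plane ` A) = emeasure (planar \<nu>) A"
proof -
  have "inj embed_plane" by (auto simp: inj_def embed_plane_eq prod_eq_iff)
  then show ?thesis
    using emeasure_nu_planar[OF embed_plane_image_sets[OF A]] by (simp add: inj_vimage_image_eq)
qed

text \<open>\<open>real_of_ereal\<close> sends both infinities to 0, so a nonzero point lands on the
  origin only if it has an infinite coordinate; such points are null.\<close>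

lemma planar_zero: "emeasure (planar \<nu>) {0} = 0"
proof -
  have "emeasure (planar \<nu>) {0} = emeasure \<nu> ((\<lambda>x. (real_of_ereal (fst x), real_of_ereal (snd x))) -` {0} \<inter> space \<nu>)"
    unfolding planar_def by (intro emeasure_distr real_part_measurable) auto
  also have "\<dots> \<le> emeasure \<nu> (punctured_plane - range embed_plane)"
  proof (rule emeasure_mono)
    show "(\<lambda>x. (real_of_ereal (fst x), real_of_ereal (snd x))) -` {0} \<inter> space \<nu> \<subseteq> punctured_plane - range embed_plane"
      by (auto simp: space_nu embed_plane_eq zero_prod_def punctured_plane_def zero_ereal_def)
    show "punctured_plane - range embed_plane \<in> sets \<nu>"
      unfolding in_sets_nu using punctured_plane_open embed_plane_measurable_range by auto
  qed
  finally show ?thesis using null_infinity by simp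
qed

text \<open>Outside the ball of radius e some coordinate has modulus at least e/2. The points of the
  extended square with this property form a closed set that avoids the origin, hence a compact
  subset of the punctured plane.\<close>

lemma planar_finite:
  assumes e: "e > 0"
  shows "emeasure (planar \<nu>) {x. norm x \<ge> e} < \<infinity>"
proof -
  let ?I = "{ereal (- (e/2))<..<ereal (e/2)}"
  define K where "K = - (?I \<times> ?I)"
  have "compact K" unfolding K_def by (intro compact_closed_ereal_plane closed_Compl open_Times) auto
  moreover have Kp: "K \<subseteq> punctured_plane" using e by (auto simp: K_def punctured_plane_def)
  ultimately have "emeasure \<nu> K < \<infinity>" by (rule finite_compact)
  moreover have K: "K \<in> sets \<nu>" using Kp \<open>compact K\<close> by (auto simp: in_sets_nu compact_imp_closed)
  moreover have "emeasure (planar \<nu>) {x. norm x \<ge> e} \<le> emeasure (planar \<nu>) (embed_plane -` K)"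
  proof (rule emeasure_mono)
    show "{x. norm x \<ge> e} \<subseteq> embed_plane -` K"
    proof
      fix x :: "real \<times> real" assume "x \<in> {x. norm x \<ge> e}"
      then have "\<not> (\<bar>fst x\<bar> < e/2 \<and> \<bar>snd x\<bar> < e/2)"
        using norm_Pair_le[of "fst x" "snd x"] by auto
      then show "x \<in> embed_plane -` K" by (auto simp: K_def embed_plane_eq abs_less_iff)
    qed
    have "embed_plane -` K \<inter> space borel \<in> sets borel"
      using K by (intro measurable_sets[OF measurable_embed_plane]) (auto simp: in_sets_nu)
    then show "embed_plane -` K \<in> sets (planar \<nu>)" by simp
  qed
  ultimately show ?thesis by (simp add: emeasure_nu_planar)
qed

lemma integral_planar:
  fixes f :: "ereal \<times> ereal \<Rightarrow> real"
  assumes F: "F \<in> borel_measurable borel" and f: "f \<in> borel_measurable borel"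
    and eq: "\<And>x. f (embed_plane x) = F x"
  shows "integral\<^sup>L \<nu> f = integral\<^sup>L (planar \<nu>) F"
proof -
  have "integral\<^sup>L (planar \<nu>) F = (\<integral>x. F (real_of_ereal (fst x), real_of_ereal (snd x)) \<partial>\<nu>)"
    unfolding planar_def by (intro integral_distr real_part_measurable F)
  also have "\<dots> = integral\<^sup>L \<nu> f"
  proof (rule integral_cong_AE)
    show "(\<lambda>x. F (real_of_ereal (fst x), real_of_ereal (snd x))) \<in> borel_measurable \<nu>"
      using measurable_compose[OF real_part_measurable F] .
    show "f \<in> borel_measurable \<nu>" by (rule measurable_borel_nu[OF f])
    show "AE x in \<nu>. F (real_of_ereal (fst x), real_of_ereal (snd x)) = f x"
      using AE_real
    proof eventually_elim
      case (elim x)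
      then obtain y where "x = embed_plane y" by blast
      then show ?case by (simp add: embed_plane_eq eq[symmetric])
    qed
  qed
  finally show ?thesis by simp
qed

end

lemma Cc_puncturedI:
  assumes "continuous_on UNIV F" "e > 0" "\<And>x. norm x < e \<Longrightarrow> F x = 0" "\<And>x. norm x > R \<Longrightarrow> F x = 0"
  shows "F \<in> Cc_punctured"
  using assms unfolding Cc_punctured_def by blast

context tail_setup
begin

lemma integral_scaled_law:
  fixes f :: "ereal \<times> ereal \<Rightarrow> real"
  assumes [measurable]: "X1 \<in> borel_measurable M" "X2 \<in> borel_measurable M"
    and g: "continuous_on UNIV g" "\<And>x. g x = (if x \<in> punctured_plane then f x else 0)" and s: "s > 0"
  shows "integral\<^sup>L (scaled_law M b X1 X2 s) f = b s * expectation (\<lambda>w. g (embed_plane (X1 w / s, X2 w / s)))"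
proof -
  have gm[measurable]: "g \<in> borel_measurable borel" by (rule borel_measurable_continuous_onI[OF g(1)])
  have [measurable]: "(\<lambda>w. (X1 w / s, X2 w / s)) \<in> M \<rightarrow>\<^sub>M borel"
    unfolding borel_prod[symmetric] by measurable
  define D where "D = distr M borel (\<lambda>w. embed_plane (X1 w / s, X2 w / s))"
  have [simp]: "sets D = sets borel" "space D = UNIV" by (simp_all add: D_def)
  have "f \<in> borel_measurable (restrict_space D punctured_plane) \<longleftrightarrow> g \<in> borel_measurable (restrict_space D punctured_plane)"
    by (intro measurable_cong) (simp add: g(2) space_restrict_space)
  moreover have "g \<in> borel_measurable (restrict_space D punctured_plane)"
    by (intro measurable_restrict_space1) (simp add: gm measurable_cong_sets[of D borel])
  ultimately have f: "f \<in> borel_measurable (restrict_space D punctured_plane)" by simp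
  have "integral\<^sup>L (scaled_law M b X1 X2 s) f = b s * integral\<^sup>L (restrict_space D punctured_plane) f"
    unfolding scaled_law_def D_def[symmetric] using b_pos[OF s] f
    by (intro integral_scale_measure) auto
  also have "integral\<^sup>L (restrict_space D punctured_plane) f = integral\<^sup>L D (\<lambda>x. indicator punctured_plane x *\<^sub>R f x)"
    using punctured_plane_open by (intro integral_restrict_space) auto
  also have "(\<lambda>x. indicator punctured_plane x *\<^sub>R f x) = g"
    by (auto simp: g(2) indicator_def)
  also have "integral\<^sup>L D g = expectation (\<lambda>w. g (embed_plane (X1 w / s, X2 w / s)))"
    unfolding D_def by (intro integral_distr) auto
  finally show ?thesis .
qed

end

section \<open>Measures on the punctured plane\<close>

text \<open>A continuous substitute for the indicator of t > 0: it lies below that indicator and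
  equals 1 from t = 1 on.\<close>

definition ramp :: "real \<Rightarrow> real" where
  "ramp t = max 0 (min 1 t)"

lemma ramp_nonneg: "ramp t \<ge> 0" and ramp_le_1: "ramp t \<le> 1"
  and ramp_0: "t \<le> 0 \<Longrightarrow> ramp t = 0" and ramp_1: "t \<ge> 1 \<Longrightarrow> ramp t = 1"
  and ramp_mono: "t \<le> u \<Longrightarrow> ramp t \<le> ramp u"
  by (auto simp: ramp_def)

lemma continuous_on_ramp [continuous_intros]: "continuous_on A f \<Longrightarrow> continuous_on A (\<lambda>x. ramp (f x))"
  unfolding ramp_def by (intro continuous_intros)

text \<open>Measures on the plane without the origin that are finite even near infinity but possibly
  infinite near the origin. They are carried on the whole plane, with the origin null, so that the
  usual Borel sets apply.\<close>

locale punctured_measure =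
  fixes N :: "(real \<times> real) measure"
  assumes sets_N [simp, measurable_cong]: "sets N = sets borel"
    and N_zero: "emeasure N {0} = 0"
    and N_finite: "e > 0 \<Longrightarrow> emeasure N {x. norm x \<ge> e} < \<infinity>"
begin

lemma space_N [simp]: "space N = UNIV"
  using sets_eq_imp_space_eq[OF sets_N] by simp

lemma N_finite_subset:
  assumes "A \<subseteq> {x. norm x \<ge> e}" "e > 0"
  shows "emeasure N A < \<infinity>"
proof -
  have "{x :: real \<times> real. norm x \<ge> e} \<in> sets N" by simp
  then show ?thesis
    using emeasure_mono[OF assms(1)] N_finite[OF assms(2)] by (meson le_less_trans)
qed

lemma integrable_Cc:
  assumes F: "F \<in> Cc_punctured" shows "integrable N F"
proof -
  obtain e where e: "e > 0" "\<And>x. norm x < e \<Longrightarrow> F x = 0"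
    using F by (auto simp: Cc_punctured_def)
  obtain B where B: "\<And>x. \<bar>F x\<bar> \<le> B" using Cc_punctured_bounded[OF F] by blast
  show ?thesis
  proof (rule integrableI_bounded_set[where A = "{x. norm x \<ge> e}" and B = B])
    show "F \<in> borel_measurable N"
      using Cc_punctured_measurable[OF F] by (simp add: measurable_cong_sets[OF sets_N refl])
    show "emeasure N {x. e \<le> norm x} < \<infinity>" by (rule N_finite[OF e(1)])
  qed (use B e in auto)
qed

lemma emeasure_minus_zero:
  assumes "A \<in> sets borel" shows "emeasure N (A - {0}) = emeasure N A"
  using assms N_zero by (intro emeasure_Diff_null_set) (auto simp: null_sets_def)

end

text \<open>Each \<open>F n\<close> is a product of three ramps that cut off the complement of U, a
  neighbourhood of the origin and a neighbourhood of infinity. At a fixed nonzero point of U all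
  three reach 1 for large n.\<close>

lemma open_punctured_approx:
  fixes U :: "(real \<times> real) set"
  assumes U: "open U"
  obtains F where "\<And>n. F n \<in> Cc_punctured" "\<And>n x. 0 \<le> F n x" "incseq F"
    "\<And>x. (SUP n. ennreal (F n x)) = indicator (U - {0}) x"
proof
  \<comment> \<open>Inserting the origin keeps \<open>A\<close> nonempty when U is the whole plane;
    \<open>infdist\<close> to the empty set would be 0 everywhere.\<close>
  define A where "A = insert 0 (- U)"
  have A: "closed A" "A \<noteq> {}"
    using closed_insert[OF closed_Compl[OF U]] by (simp_all add: A_def)
  define F where "F n x = ramp (real n * infdist x A) * (ramp (real n * norm x - 1) * ramp (real n - norm x))"
    for n :: nat and x :: "real \<times> real"
  show nn: "0 \<le> F n x" for n x by (simp add: F_def ramp_nonneg)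
  show "F n \<in> Cc_punctured" for n
  \<comment> \<open>The radius has n + 1 in place of n so that n = 0 is covered.\<close>
  proof (rule Cc_puncturedI[where e = "1 / (real n + 1)" and R = "real n"])
    show "continuous_on UNIV (F n)" unfolding F_def by (intro continuous_intros)
  next
    fix x :: "real \<times> real"
    assume "norm x < 1 / (real n + 1)"
    then have "norm x * (real n + 1) < 1" by (simp add: field_simps)
    moreover have "real n * norm x \<le> norm x * (real n + 1)" by (simp add: algebra_simps)
    ultimately have "real n * norm x \<le> 1" by linarith
    then show "F n x = 0" by (simp add: F_def ramp_0)
  next
    fix x :: "real \<times> real"
    assume "real n < norm x" then show "F n x = 0" by (simp add: F_def ramp_0)
  qed simp
  show inc: "incseq F"
    unfolding incseq_def le_fun_def F_def
    by (intro allI impI mult_mono ramp_mono mult_nonneg_nonneg ramp_nonneg mult_right_mono diff_mono)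
      (auto simp: infdist_nonneg)
  fix x
  show "(SUP n. ennreal (F n x)) = indicator (U - {0}) x"
  proof (cases "x \<in> U - {0}")
    case True
    then have "x \<notin> A" by (auto simp: A_def)
    then have i: "infdist x A > 0" using A infdist_pos_not_in_closed by blast
    obtain n1 where n1: "1 / infdist x A < real n1" using reals_Archimedean2 by blast
    obtain n2 where n2: "2 / norm x < real n2" using reals_Archimedean2 by blast
    obtain n3 where n3: "norm x + 1 < real n3" using reals_Archimedean2 by blast
    define n where "n = max n1 (max n2 n3)"
    have "1 / infdist x A \<le> real n" "2 / norm x \<le> real n" "norm x + 1 \<le> real n"
      using n1 n2 n3 by (auto simp: n_def)
    then have "1 \<le> real n * infdist x A" "1 \<le> real n * norm x - 1" "1 \<le> real n - norm x"
      using i True by (simp_all add: pos_divide_le_eq)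
    then have "F n x = 1" by (simp add: F_def ramp_1)
    then have "1 \<le> (SUP n. ennreal (F n x))" by (intro SUP_upper2[of n]) auto
    moreover have "(SUP n. ennreal (F n x)) \<le> 1"
      by (intro SUP_least) (auto simp: F_def ramp_le_1 ramp_nonneg intro!: mult_le_one)
    ultimately show ?thesis using True by simp
  next
    case False
    then have "x \<in> A" by (auto simp: A_def)
    then have "F n x = 0" for n by (simp add: F_def ramp_0)
    then show ?thesis using False by simp
  qed
qed

text \<open>Monotone convergence carries equality from test functions to open sets without the
  origin. As both measures may be infinite near 0, uniqueness from the intersection-stable generator
  is applied outside small balls, which are then shrunk to the null set of the origin.\<close>

lemma punctured_measure_eqI:
  assumes N: "punctured_measure N" and N': "punctured_measure N'"
    and eq: "\<And>F. F \<in> Cc_punctured \<Longrightarrow> integral\<^sup>L N F = integral\<^sup>L N' F"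
  shows "N = N'"
proof -
  interpret N: punctured_measure N by fact
  interpret N': punctured_measure N' by fact
  have em: "emeasure K (U - {0}) = (SUP n. ennreal (integral\<^sup>L K (F n)))"
    if K: "punctured_measure K" and F: "\<And>n. F n \<in> Cc_punctured" "\<And>n x. 0 \<le> F n x" "incseq F"
      "\<And>x. (SUP n. ennreal (F n x)) = indicator (U - {0}) x" and U: "open U" for K U F
  proof -
    interpret K: punctured_measure K by fact
    have "emeasure K (U - {0}) = (\<integral>\<^sup>+x. indicator (U - {0}) x \<partial>K)"
      using U by (intro nn_integral_indicator[symmetric]) auto
    also have "\<dots> = (\<integral>\<^sup>+x. (SUP n. ennreal (F n x)) \<partial>K)" by (simp add: F(4))
    also have "\<dots> = (SUP n. \<integral>\<^sup>+x. ennreal (F n x) \<partial>K)"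
    proof (rule nn_integral_monotone_convergence_SUP)
      show "incseq (\<lambda>n x. ennreal (F n x))"
        using F(3) by (auto simp: incseq_def le_fun_def intro!: ennreal_leI)
      show "(\<lambda>x. ennreal (F n x)) \<in> borel_measurable K" for n
        using Cc_punctured_measurable[OF F(1)[of n]] by (simp add: measurable_cong_sets[OF K.sets_N refl])
    qed
    also have "\<dots> = (SUP n. ennreal (integral\<^sup>L K (F n)))"
      using F(2) by (simp add: nn_integral_eq_integral[OF K.integrable_Cc[OF F(1)]])
    finally show ?thesis .
  qed
  have open_eq: "emeasure N (U - {0}) = emeasure N' (U - {0})" if U: "open U" for U
  proof -
    obtain F where F: "\<And>n. F n \<in> Cc_punctured" "\<And>n x. 0 \<le> F n x" "incseq F"
      "\<And>x. (SUP n. ennreal (F n x)) = indicator (U - {0}) x"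
      using open_punctured_approx[OF U] by blast
    from em[OF N F U] em[OF N' F U] eq[OF F(1)] show ?thesis by simp
  qed
  define C where "C n = {x :: real \<times> real. norm x > 1 / (real n + 1)}" for n :: nat
  have oC: "open (C n)" for n unfolding C_def by (intro open_Collect_less continuous_intros)
  have C0: "0 \<notin> C n" for n by (auto simp: C_def)
  have Csub: "C n \<subseteq> {x. norm x \<ge> 1 / (real n + 1)}" for n by (auto simp: C_def)
  \<comment> \<open>Written as densities with an indicator, the restrictions are finite measures on
    the whole plane, so \<open>UNIV\<close> alone serves as exhausting sequence.\<close>
  have dens: "density N (indicator (C n)) = density N' (indicator (C n))" for n
  proof (rule measure_eqI_generator_eq[where E = "{U. open U}" and \<Omega> = UNIV and A = "\<lambda>_. UNIV"])
    show "Int_stable {U :: (real \<times> real) set. open U}" by (auto simp: Int_stable_def)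
    fix U :: "(real \<times> real) set" assume "U \<in> {U. open U}"
    then have U: "open U" by simp
    then have o: "open (C n \<inter> U)" using oC by blast
    have "C n \<inter> U - {0} = C n \<inter> U" using C0 by auto
    with open_eq[OF o] U oC[of n] show "emeasure (density N (indicator (C n))) U = emeasure (density N' (indicator (C n))) U"
      by (simp add: emeasure_restricted)
  next
    show "emeasure (density N (indicator (C n))) UNIV \<noteq> \<infinity>"
      using N.N_finite_subset[OF Csub[of n]] oC[of n] by (simp add: emeasure_restricted less_top)
  qed (auto simp: borel_def)
  show "N = N'"
  proof (rule measure_eqI)
    fix A assume "A \<in> sets N"
    then have A[measurable]: "A \<in> sets borel" by simp
    have CA: "emeasure N (C n \<inter> A) = emeasure N' (C n \<inter> A)" for n
      using arg_cong[OF dens[of n], of "\<lambda>K. emeasure K A"] oC[of n] A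
      by (simp add: emeasure_restricted)
    have inc: "incseq (\<lambda>n. C n \<inter> A)"
    proof (rule incseq_SucI)
      fix n :: nat
      have "1 / (real (Suc n) + 1) \<le> 1 / (real n + 1)" by (simp add: frac_le)
      then show "C n \<inter> A \<subseteq> C (Suc n) \<inter> A" by (auto simp: C_def simp del: of_nat_Suc)
    qed
    have un: "(\<Union>n. C n \<inter> A) = A - {0}"
    proof (intro equalityI subsetI)
      fix x assume x: "x \<in> A - {0}"
      then obtain n where n: "1 / norm x < real n" using reals_Archimedean2 by blast
      have "1 / norm x < real n + 1" using n by linarith
      then have "1 < (real n + 1) * norm x" using x by (simp add: pos_divide_less_eq)
      then have "1 / (real n + 1) < norm x" by (simp add: pos_divide_less_eq mult.commute)
      then show "x \<in> (\<Union>n. C n \<inter> A)" using x by (auto simp: C_def)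
    qed (use C0 in auto)
    have "emeasure N A = emeasure N (\<Union>n. C n \<inter> A)" by (simp only: un N.emeasure_minus_zero[OF A])
    also have "\<dots> = (SUP n. emeasure N (C n \<inter> A))"
      using oC by (intro SUP_emeasure_incseq[symmetric] inc) auto
    also have "\<dots> = (SUP n. emeasure N' (C n \<inter> A))" by (simp add: CA)
    also have "\<dots> = emeasure N' (\<Union>n. C n \<inter> A)"
      using oC by (intro SUP_emeasure_incseq inc) auto
    also have "\<dots> = emeasure N' A" by (simp only: un N'.emeasure_minus_zero[OF A])
    finally show "emeasure N A = emeasure N' A" .
  qed simp
qed

section \<open>The angular part of a measure\<close>

lemma ennreal_inverse_square_cancel:
  assumes "r > 0"
  shows "ennreal (1 / r\<^sup>2) * (ennreal (r\<^sup>2) * x) = x"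
proof -
  have "ennreal (1 / r\<^sup>2) * ennreal (r\<^sup>2) = 1"
    using assms by (simp add: ennreal_mult'[symmetric])
  then show ?thesis by (simp add: mult.assoc[symmetric])
qed

text \<open>The defining identity of an angular measure at r = 1 leaves no other choice: the mass
  outside the closed unit disc, projected radially. For homogeneous \<open>N\<close> the identity
  then holds at every radius.\<close>

definition angular_of :: "(real \<times> real) measure \<Rightarrow> (real \<times> real) measure" where
  "angular_of N = distr (restrict_space N {x. norm x > 1}) (restrict_space borel (sphere 0 1)) (\<lambda>x. x /\<^sub>R norm x)"

lemma sets_angular_of: "sets (angular_of N) = sets (restrict_space borel (sphere 0 1))"
  by (simp add: angular_of_def)

lemma space_angular_of: "space (angular_of N) = sphere 0 1"
  by (simp add: angular_of_def space_restrict_space)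

lemma in_sets_circle: "B \<in> sets (restrict_space borel (sphere (0 :: real \<times> real) 1)) \<longleftrightarrow> B \<subseteq> sphere 0 1 \<and> B \<in> sets borel"
  by (subst sets_restrict_space_iff) auto

lemma cone_sets:
  assumes "B \<in> sets borel"
  shows "{x :: real \<times> real. norm x > r \<and> x /\<^sub>R norm x \<in> B} \<in> sets borel"
proof -
  have [measurable]: "B \<in> sets borel" by fact
  show ?thesis by measurable
qed

lemma emeasure_angular_of:
  assumes N: "sets N = sets borel" and B: "B \<in> sets (angular_of N)"
  shows "emeasure (angular_of N) B = emeasure N {x. norm x > 1 \<and> x /\<^sub>R norm x \<in> B}"
proof -
  have sp: "space N = UNIV" using sets_eq_imp_space_eq[OF N] by simp
  have [measurable_cong]: "sets N = sets borel" by fact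
  have B': "B \<in> sets (restrict_space borel (sphere 0 1))" "B \<in> sets borel"
    using B by (simp_all add: sets_angular_of in_sets_circle)
  have o: "{x :: real \<times> real. norm x > 1} \<in> sets borel" by measurable
  have meas: "(\<lambda>x. x /\<^sub>R norm x) \<in> restrict_space N {x. norm x > 1} \<rightarrow>\<^sub>M restrict_space borel (sphere 0 1)"
  proof (rule measurable_restrict_space2)
    have "(\<lambda>x. x /\<^sub>R norm x) \<in> N \<rightarrow>\<^sub>M (borel :: (real \<times> real) measure)" by measurable
    then show "(\<lambda>x. x /\<^sub>R norm x) \<in> restrict_space N {x. norm x > 1} \<rightarrow>\<^sub>M borel"
      by (rule measurable_restrict_space1)
    have "x /\<^sub>R norm x \<in> sphere 0 1" if "norm x > 1" for x :: "real \<times> real"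
    proof -
      have "x \<noteq> 0" using that by auto
      then show ?thesis by simp
    qed
    then show "(\<lambda>x. x /\<^sub>R norm x) \<in> space (restrict_space N {x. norm x > 1}) \<rightarrow> sphere 0 1"
      unfolding space_restrict_space sp by (intro Pi_I) blast
  qed
  have eq: "(\<lambda>x. x /\<^sub>R norm x) -` B \<inter> space (restrict_space N {x. norm x > 1}) = {x. norm x > 1 \<and> x /\<^sub>R norm x \<in> B}"
    by (auto simp: space_restrict_space sp)
  have "emeasure (angular_of N) B = emeasure (restrict_space N {x. norm x > 1}) {x. norm x > 1 \<and> x /\<^sub>R norm x \<in> B}"
    unfolding angular_of_def eq[symmetric] by (rule emeasure_distr[OF meas B'(1)])
  also have "\<dots> = emeasure N {x. norm x > 1 \<and> x /\<^sub>R norm x \<in> B}"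
    using o by (intro emeasure_restrict_space) (auto simp: N sp)
  finally show ?thesis .
qed

lemma finite_angular_of:
  assumes N: "punctured_measure N" shows "finite_measure (angular_of N)"
proof
  interpret punctured_measure N by fact
  have "emeasure (angular_of N) (space (angular_of N)) \<le> emeasure N {x. norm x \<ge> 1}"
    unfolding emeasure_angular_of[OF sets_N sets.top] by (intro emeasure_mono) auto
  then show "emeasure (angular_of N) (space (angular_of N)) \<noteq> \<infinity>"
    using N_finite[of 1] by (auto simp: top_unique)
qed

section \<open>Tail measures\<close>

context tail_setup
begin

text \<open>Convergence is tested only on functions that vanish near infinity. This identifies
  \<open>N\<close>, but mass of the scaled laws escaping to infinity goes unseen and has to be
  estimated through the marginal tails.\<close>

definition planar_tail :: "('a \<Rightarrow> real) \<Rightarrow> ('a \<Rightarrow> real) \<Rightarrow> (real \<times> real) measure \<Rightarrow> bool" where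
  "planar_tail X1 X2 N \<longleftrightarrow> punctured_measure N \<and>
     (\<forall>F\<in>Cc_punctured. ((\<lambda>s. b s * expectation (\<lambda>w. F (X1 w / s, X2 w / s))) \<longlongrightarrow> integral\<^sup>L N F) at_top)"

lemma plane_measure_tail: "is_tail_measure M b X1 X2 \<nu> \<Longrightarrow> plane_measure \<nu>"
  by (auto simp: is_tail_measure_def plane_measure_def)

lemma planar_tail_planar:
  assumes X: "X1 \<in> borel_measurable M" "X2 \<in> borel_measurable M"
    and nu: "is_tail_measure M b X1 X2 \<nu>"
  shows "planar_tail X1 X2 (planar \<nu>)"
proof -
  interpret plane_measure \<nu> by (rule plane_measure_tail[OF nu])
  show ?thesis
    unfolding planar_tail_def
  proof (intro conjI ballI)
    show "punctured_measure (planar \<nu>)"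
      using planar_finite by (simp add: punctured_measure_def planar_zero)
    fix F assume F: "F \<in> Cc_punctured"
    obtain f K where f: "continuous_on UNIV f" "compact K" "K \<subseteq> punctured_plane"
      "\<forall>x\<in>punctured_plane - K. f x = 0" "\<And>x. f (embed_plane x) = F x" "f (0, 0) = 0"
      using Cc_punctured_extend[OF F] by blast
    have fp: "f x = (if x \<in> punctured_plane then f x else 0)" for x
      using f(6) by (auto simp: punctured_plane_def)
    have "continuous_on punctured_plane f" using f(1) by (rule continuous_on_subset) simp
    then have "((\<lambda>s. integral\<^sup>L (scaled_law M b X1 X2 s) f) \<longlongrightarrow> integral\<^sup>L \<nu> f) at_top"
      using nu f(2-4) unfolding is_tail_measure_def vaguely_converges_on_def by blast
    also have "integral\<^sup>L \<nu> f = integral\<^sup>L (planar \<nu>) F"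
      by (rule integral_planar[OF Cc_punctured_measurable[OF F] borel_measurable_continuous_onI[OF f(1)] f(5)])
    finally have lim: "((\<lambda>s. integral\<^sup>L (scaled_law M b X1 X2 s) f) \<longlongrightarrow> integral\<^sup>L (planar \<nu>) F) at_top" .
    show "((\<lambda>s. b s * expectation (\<lambda>w. F (X1 w / s, X2 w / s))) \<longlongrightarrow> integral\<^sup>L (planar \<nu>) F) at_top"
    proof (rule Lim_transform_eventually[OF lim])
      show "\<forall>\<^sub>F s in at_top. integral\<^sup>L (scaled_law M b X1 X2 s) f = b s * expectation (\<lambda>w. F (X1 w / s, X2 w / s))"
        using eventually_gt_at_top[of 0]
        by eventually_elim (simp add: integral_scaled_law[OF X f(1) fp] f(5))
    qed
  qed
qed

lemma planar_tail_unique: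
  assumes "planar_tail X1 X2 N" "planar_tail X1 X2 N'" shows "N = N'"
proof (rule punctured_measure_eqI)
  fix F assume "F \<in> Cc_punctured"
  with assms show "integral\<^sup>L N F = integral\<^sup>L N' F"
    unfolding planar_tail_def using tendsto_unique[OF trivial_limit_at_top_linorder] by blast
qed (use assms in \<open>auto simp: planar_tail_def\<close>)

text \<open>Two tail measures have the same planar image by uniqueness of limits, and each is
  recovered from that image by \<open>emeasure_nu_planar\<close>. Hence the description by
  \<open>THE\<close> denotes.\<close>

lemma tail_measure_eq:
  assumes X: "X1 \<in> borel_measurable M" "X2 \<in> borel_measurable M"
    and nu: "is_tail_measure M b X1 X2 \<nu>"
  shows "tail_measure M b X1 X2 = \<nu>"
  unfolding tail_measure_def
proof (rule the_equality[of "is_tail_measure M b X1 X2", OF nu])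
  fix \<nu>' assume nu': "is_tail_measure M b X1 X2 \<nu>'"
  interpret p: plane_measure \<nu> by (rule plane_measure_tail[OF nu])
  interpret p': plane_measure \<nu>' by (rule plane_measure_tail[OF nu'])
  have eq: "planar \<nu>' = planar \<nu>"
    by (rule planar_tail_unique[OF planar_tail_planar[OF X nu'] planar_tail_planar[OF X nu]])
  show "\<nu>' = \<nu>"
    by (rule measure_eqI) (auto simp: p.sets_nu p'.sets_nu p.emeasure_nu_planar p'.emeasure_nu_planar eq)
qed

section \<open>Homogeneity of the limit measure\<close>

lemma Cc_punctured_scale:
  assumes F: "F \<in> Cc_punctured" and t: "t > 0"
  shows "(\<lambda>x. F (x /\<^sub>R t)) \<in> Cc_punctured"
proof -
  obtain e R where F: "continuous_on UNIV F" "e > 0" "\<And>x. norm x < e \<Longrightarrow> F x = 0" "\<And>x. norm x > R \<Longrightarrow> F x = 0"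
    using F by (auto simp: Cc_punctured_def)
  show ?thesis
  proof (rule Cc_puncturedI[where e = "e * t" and R = "R * t"])
    show "continuous_on UNIV (\<lambda>x. F (x /\<^sub>R t))"
      by (rule continuous_on_compose2[OF F(1)]) (auto intro!: continuous_intros)
  qed (use F t in \<open>auto simp: field_simps\<close>)
qed

text \<open>The measure \<open>N'\<close>, the image of \<open>N\<close> under division by t
  multiplied by t^2, is a limit of the same scaled laws, so uniqueness of the limit gives
  \<open>N' = N\<close>.\<close>

lemma planar_tail_homogeneous:
  assumes N: "planar_tail X1 X2 N" and t: "t > 0" and A: "A \<in> sets borel"
  shows "emeasure N A = ennreal (t\<^sup>2) * emeasure N {x. x /\<^sub>R t \<in> A}"
proof -
  interpret punctured_measure N using N by (simp add: planar_tail_def)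
  have meas[measurable]: "(\<lambda>x. x /\<^sub>R t) \<in> N \<rightarrow>\<^sub>M borel" by measurable
  define N' where "N' = scale_measure (ennreal (t\<^sup>2)) (distr N borel (\<lambda>x. x /\<^sub>R t))"
  have em: "emeasure N' A = ennreal (t\<^sup>2) * emeasure N {x. x /\<^sub>R t \<in> A}" if "A \<in> sets borel" for A
    using that by (simp add: N'_def emeasure_distr vimage_def)
  have "planar_tail X1 X2 N'"
    unfolding planar_tail_def
  proof (intro conjI ballI)
    show "punctured_measure N'"
    proof
      show "sets N' = sets borel" by (simp add: N'_def)
      have "{x :: real \<times> real. x /\<^sub>R t \<in> {0}} = {0}" using t by auto
      then show "emeasure N' {0} = 0" using em[of "{0}"] N_zero by simp
      fix e :: real assume "e > 0"
      then have "emeasure N {x. norm x \<ge> e * t} < \<infinity>" using t by (intro N_finite) simp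
      moreover have "{x. x /\<^sub>R t \<in> {x. norm x \<ge> e}} = {x :: real \<times> real. norm x \<ge> e * t}"
        using t by (auto simp: field_simps)
      ultimately show "emeasure N' {x. norm x \<ge> e} < \<infinity>"
        using em[of "{x. norm x \<ge> e}"] by (simp add: ennreal_mult_less_top)
    qed
    fix F assume F: "F \<in> Cc_punctured"
    note Fm = Cc_punctured_measurable[OF F]
    have "((\<lambda>s. b s * expectation (\<lambda>w. F ((X1 w / s, X2 w / s) /\<^sub>R t))) \<longlongrightarrow> integral\<^sup>L N (\<lambda>x. F (x /\<^sub>R t))) at_top"
      using bspec[OF _ Cc_punctured_scale[OF F t]] N unfolding planar_tail_def by fast
    \<comment> \<open>Reading the limit along s/t undoes the division of the argument by t; the
      factor t^2 is the limit of b(s)/b(s/t).\<close>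
    moreover have "filterlim (\<lambda>s. s * (1 / t)) at_top at_top"
      using t by (intro filterlim_mult_const_at_top) simp
    ultimately have "((\<lambda>s. b (s * (1 / t)) * expectation (\<lambda>w. F ((X1 w / (s * (1 / t)), X2 w / (s * (1 / t))) /\<^sub>R t)))
        \<longlongrightarrow> integral\<^sup>L N (\<lambda>x. F (x /\<^sub>R t))) at_top"
      by (rule filterlim_compose)
    then have "((\<lambda>s. b s / b (s * (1 / t)) * (b (s * (1 / t)) * expectation (\<lambda>w. F ((X1 w / (s * (1 / t)), X2 w / (s * (1 / t))) /\<^sub>R t))))
        \<longlongrightarrow> 1 / (1 / t)\<^sup>2 * integral\<^sup>L N (\<lambda>x. F (x /\<^sub>R t))) at_top"
      using t by (intro tendsto_mult b_ratio) auto
    moreover have "integral\<^sup>L N' F = t\<^sup>2 * integral\<^sup>L N (\<lambda>x. F (x /\<^sub>R t))"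
      unfolding N'_def using Fm by (simp add: integral_scale_measure integral_distr)
    then have "integral\<^sup>L N' F = 1 / (1 / t)\<^sup>2 * integral\<^sup>L N (\<lambda>x. F (x /\<^sub>R t))"
      by (simp add: power_one_over)
    ultimately have lim: "((\<lambda>s. b s / b (s * (1 / t)) * (b (s * (1 / t)) * expectation (\<lambda>w. F ((X1 w / (s * (1 / t)), X2 w / (s * (1 / t))) /\<^sub>R t))))
        \<longlongrightarrow> integral\<^sup>L N' F) at_top" by (simp only:)
    show "((\<lambda>s. b s * expectation (\<lambda>w. F (X1 w / s, X2 w / s))) \<longlongrightarrow> integral\<^sup>L N' F) at_top"
    proof (rule Lim_transform_eventually[OF lim])
      show "\<forall>\<^sub>F s in at_top. b s / b (s * (1 / t)) * (b (s * (1 / t)) * expectation (\<lambda>w. F ((X1 w / (s * (1 / t)), X2 w / (s * (1 / t))) /\<^sub>R t)))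
         = b s * expectation (\<lambda>w. F (X1 w / s, X2 w / s))"
        using eventually_gt_at_top[of 0]
      proof eventually_elim
        case (elim s)
        then have p: "b (s * (1 / t)) > 0" using t by (intro b_pos) simp
        have e: "(X1 w / (s * (1 / t)), X2 w / (s * (1 / t))) /\<^sub>R t = (X1 w / s, X2 w / s)" for w
          using t elim by (simp add: field_simps)
        show ?case unfolding e using p by simp
      qed
    qed
  qed
  from planar_tail_unique[OF N this] em[OF A] show ?thesis by simp
qed

section \<open>Tails of linear combinations\<close>

lemma prob_norm_ge_le:
  assumes [measurable]: "X1 \<in> borel_measurable M" "X2 \<in> borel_measurable M" and s: "s > 0" and e: "e > 0"
  shows "prob {w \<in> space M. norm (X1 w / s, X2 w / s) \<ge> e}
    \<le> prob {w \<in> space M. \<bar>X1 w\<bar> > s * (e / 4)} + prob {w \<in> space M. \<bar>X2 w\<bar> > s * (e / 4)}"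
proof -
  have "prob {w \<in> space M. norm (X1 w / s, X2 w / s) \<ge> e}
     \<le> prob ({w \<in> space M. \<bar>X1 w\<bar> > s * (e / 4)} \<union> {w \<in> space M. \<bar>X2 w\<bar> > s * (e / 4)})"
  proof (rule finite_measure_mono)
    show "{w \<in> space M. norm (X1 w / s, X2 w / s) \<ge> e}
        \<subseteq> {w \<in> space M. \<bar>X1 w\<bar> > s * (e / 4)} \<union> {w \<in> space M. \<bar>X2 w\<bar> > s * (e / 4)}"
    proof (rule subsetI, rule ccontr)
      fix w assume w: "w \<in> {w \<in> space M. norm (X1 w / s, X2 w / s) \<ge> e}"
        "w \<notin> {w \<in> space M. \<bar>X1 w\<bar> > s * (e / 4)} \<union> {w \<in> space M. \<bar>X2 w\<bar> > s * (e / 4)}"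
      \<comment> \<open>The norm is bounded by the sum of the moduli. Thresholds e/2 would still
        allow norm e; e/4 gives at most e/2 and so a contradiction.\<close>
      then have "\<bar>X1 w\<bar> / s \<le> e / 4" "\<bar>X2 w\<bar> / s \<le> e / 4"
        using s by (auto simp: pos_divide_le_eq mult.commute)
      then have "norm (X1 w / s) + norm (X2 w / s) \<le> e / 4 + e / 4"
        using s by (intro add_mono) auto
      then have "norm (X1 w / s, X2 w / s) \<le> e / 4 + e / 4"
        using norm_Pair_le[of "X1 w / s" "X2 w / s"] by linarith
      with w(1) e show False by auto
    qed
  qed auto
  also have "\<dots> \<le> prob {w \<in> space M. \<bar>X1 w\<bar> > s * (e / 4)} + prob {w \<in> space M. \<bar>X2 w\<bar> > s * (e / 4)}"
    by (intro measure_Un_le) auto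
  finally show ?thesis .
qed

lemma V_space_measurable: "X \<in> V_space M b \<Longrightarrow> X \<in> borel_measurable M"
  by (simp add: V_space_def)

lemma measurable_scaled_pair:
  fixes X1 X2 :: "'a \<Rightarrow> real"
  assumes [measurable]: "X1 \<in> borel_measurable M" "X2 \<in> borel_measurable M"
  shows "(\<lambda>w. (X1 w / s, X2 w / s)) \<in> borel_measurable M"
  unfolding borel_prod[symmetric] by measurable

text \<open>The gap between u and v leaves room for a continuous transition: \<open>F R\<close> lies
  below the indicator of |l| > u and is 1 where |l| > v within radius R. The first property gives
  the upper bound directly. The lower bound costs the part of the scaled law outside radius R, which
  the marginal tails limit to a multiple of R^-2.\<close>

lemma planar_tail_linear_bounds:
  fixes a c :: real
  assumes N: "planar_tail X1 X2 N" and X: "X1 \<in> V_space M b" "X2 \<in> V_space M b"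
    and q: "right_tail (\<lambda>w. \<bar>a * X1 w + c * X2 w\<bar>) q" and u: "0 < u" "u < v"
  shows "emeasure N {x. \<bar>a * fst x + c * snd x\<bar> > v} \<le> ennreal (q / u\<^sup>2)"
    and "emeasure N {x. \<bar>a * fst x + c * snd x\<bar> > u} < \<infinity>"
    and "q / v\<^sup>2 \<le> measure N {x. \<bar>a * fst x + c * snd x\<bar> > u}"
proof -
  interpret punctured_measure N using N by (simp add: planar_tail_def)
  note [measurable] = V_space_measurable[OF X(1)] V_space_measurable[OF X(2)]
  define l where "l x = a * fst x + c * snd x" for x :: "real \<times> real"
  \<comment> \<open>The summand 1 keeps \<open>C\<close> positive when a = c = 0.\<close>
  define C where "C = \<bar>a\<bar> + \<bar>c\<bar> + 1"
  have C: "C > 0" by (simp add: C_def add_nonneg_pos)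
  have lC: "\<bar>l x\<bar> \<le> C * norm x" for x
  proof -
    have "\<bar>l x\<bar> \<le> \<bar>a\<bar> * \<bar>fst x\<bar> + \<bar>c\<bar> * \<bar>snd x\<bar>"
      unfolding l_def by (metis abs_mult abs_triangle_ineq)
    also have "\<dots> \<le> \<bar>a\<bar> * norm x + \<bar>c\<bar> * norm x"
      using norm_fst_le[of "fst x" "snd x"] norm_snd_le[of "snd x" "fst x"]
      by (intro add_mono mult_left_mono) auto
    also have "\<dots> \<le> C * norm x" by (simp add: C_def algebra_simps)
    finally show ?thesis .
  qed
  have cl: "continuous_on UNIV l" unfolding l_def by (intro continuous_intros)
  have lm[measurable]: "l \<in> borel_measurable borel" by (rule borel_measurable_continuous_onI[OF cl])
  have ls: "l (X1 w / s, X2 w / s) = (a * X1 w + c * X2 w) / s" for w s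
    by (simp add: l_def add_divide_distrib)
  have Au: "{x. \<bar>l x\<bar> > u} \<subseteq> {x. norm x \<ge> u / C}"
    using C lC by (auto simp: pos_divide_le_eq mult.commute) (meson less_le_trans less_imp_le)
  have fin: "emeasure N {x. \<bar>l x\<bar> > u} < \<infinity>"
    using u C by (intro N_finite_subset[OF Au]) simp
  then show "emeasure N {x. \<bar>a * fst x + c * snd x\<bar> > u} < \<infinity>" by (simp add: l_def)
  have Am[measurable]: "{x. \<bar>l x\<bar> > t} \<in> sets borel" for t by measurable
  \<comment> \<open>The first ramp rises between the levels u and v; the second falls between the
    norms R and R + 1 and makes the support bounded.\<close>
  define F where "F R x = ramp ((\<bar>l x\<bar> - u) / (v - u)) * ramp (R + 1 - norm x)" for R x
  have F01: "0 \<le> F R x" "F R x \<le> 1" for R x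
    by (auto simp: F_def ramp_nonneg ramp_le_1 intro!: mult_le_one)
  have Fu: "F R x \<le> indicator {x. \<bar>l x\<bar> > u} x" for R x
  proof (cases "\<bar>l x\<bar> > u")
    case False then show ?thesis using u by (simp add: F_def ramp_0 divide_nonpos_pos)
  qed (use F01 in simp)
  have Fv: "F R x = 1" if "\<bar>l x\<bar> > v" "norm x \<le> R" for R x
    using that u by (simp add: F_def ramp_1)
  have FCc: "F R \<in> Cc_punctured" for R
  proof (rule Cc_puncturedI[where e = "u / C" and R = "R + 1"])
    show "continuous_on UNIV (F R)"
      unfolding F_def using u by (intro continuous_intros cl) auto
    fix x :: "real \<times> real" assume "norm x < u / C"
    then have "C * norm x < u" using C by (simp add: field_simps)
    with lC[of x] u show "F R x = 0" by (simp add: F_def ramp_0 divide_nonpos_pos)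
  qed (use u C in \<open>auto simp: F_def ramp_0\<close>)
  note Fm[measurable] = Cc_punctured_measurable[OF FCc]
  let ?X = "\<lambda>s w. (X1 w / s, X2 w / s)"
  have Xm[measurable]: "?X s \<in> borel_measurable M" for s by (rule measurable_scaled_pair) measurable
  have Fint: "integrable M (\<lambda>w. F R (?X s w))" for R s
    by (rule integrable_const_bound[where B = 1]) (auto simp: F01)
  have lim: "((\<lambda>s. b s * expectation (\<lambda>w. F R (?X s w))) \<longlongrightarrow> integral\<^sup>L N (F R)) at_top" for R
    using N FCc unfolding planar_tail_def by blast
  have up: "integral\<^sup>L N (F R) \<le> q / u\<^sup>2" for R
  proof (rule tendsto_le[OF trivial_limit_at_top_linorder right_tailD[OF q u(1)] lim])
    show "\<forall>\<^sub>F s in at_top. b s * expectation (\<lambda>w. F R (?X s w)) \<le> b s * prob {w \<in> space M. \<bar>a * X1 w + c * X2 w\<bar> > s * u}"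
      using eventually_gt_at_top[of 0]
    proof eventually_elim
      case (elim s)
      have "expectation (\<lambda>w. F R (?X s w)) \<le> expectation (indicator {w \<in> space M. \<bar>a * X1 w + c * X2 w\<bar> > s * u})"
      proof (rule integral_mono[OF Fint])
        fix w assume "w \<in> space M"
        then show "F R (?X s w) \<le> indicator {w \<in> space M. \<bar>a * X1 w + c * X2 w\<bar> > s * u} w"
          using Fu[of R "?X s w"] elim by (auto simp: ls indicator_def field_simps split: if_splits)
      qed (auto simp: less_top[symmetric])
      then show ?case using b_pos[OF elim] by (simp add: mult_left_mono)
    qed
  qed
  have "emeasure N {x. \<bar>l x\<bar> > v} \<le> ennreal (q / u\<^sup>2)"
  proof -
    \<comment> \<open>\<open>F n\<close> equals 1 above level v only within radius n, so the bound
      is proved on balls and passes to their union.\<close>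
    let ?A = "\<lambda>n::nat. {x. \<bar>l x\<bar> > v} \<inter> cball 0 (real n)"
    have "emeasure N (?A n) \<le> ennreal (q / u\<^sup>2)" for n
    proof -
      have "emeasure N (?A n) = (\<integral>\<^sup>+x. indicator (?A n) x \<partial>N)"
        by (intro nn_integral_indicator[symmetric]) auto
      also have "\<dots> \<le> (\<integral>\<^sup>+x. ennreal (F (real n) x) \<partial>N)"
        by (intro nn_integral_mono) (auto simp: indicator_def Fv)
      also have "\<dots> = ennreal (integral\<^sup>L N (F (real n)))"
        by (intro nn_integral_eq_integral integrable_Cc FCc) (simp add: F01)
      also have "\<dots> \<le> ennreal (q / u\<^sup>2)" by (intro ennreal_leI up)
      finally show ?thesis .
    qed
    then have "(SUP n. emeasure N (?A n)) \<le> ennreal (q / u\<^sup>2)" by (intro SUP_least) auto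
    moreover have "(SUP n. emeasure N (?A n)) = emeasure N (\<Union>n. ?A n)"
      by (intro SUP_emeasure_incseq) (auto simp: incseq_def)
    moreover have "(\<Union>n. ?A n) = {x. \<bar>l x\<bar> > v}"
      using real_arch_simple by auto
    ultimately show ?thesis by simp
  qed
  then show "emeasure N {x. \<bar>a * fst x + c * snd x\<bar> > v} \<le> ennreal (q / u\<^sup>2)" by (simp add: l_def)
  define m where "m = measure N {x. \<bar>l x\<bar> > u}"
  have Fm_le: "integral\<^sup>L N (F R) \<le> m" for R
  proof -
    have "integral\<^sup>L N (F R) \<le> integral\<^sup>L N (indicator {x. \<bar>l x\<bar> > u})"
      by (rule integral_mono[OF integrable_Cc[OF FCc] _ Fu]) (use fin in auto)
    then show ?thesis by (simp add: m_def)
  qed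
  have low: "q / v\<^sup>2 \<le> m + (tail_const X1 + tail_const X2) / (R / 4)\<^sup>2" if R: "R > 0" for R
  proof -
    have "q / v\<^sup>2 \<le> integral\<^sup>L N (F R) + (tail_const X1 / (R / 4)\<^sup>2 + tail_const X2 / (R / 4)\<^sup>2)"
    proof (rule tendsto_le[OF trivial_limit_at_top_linorder _ right_tailD[OF q]])
      show "((\<lambda>s. b s * expectation (\<lambda>w. F R (?X s w)) + (b s * prob {w \<in> space M. \<bar>X1 w\<bar> > s * (R / 4)}
         + b s * prob {w \<in> space M. \<bar>X2 w\<bar> > s * (R / 4)})) \<longlongrightarrow>
         integral\<^sup>L N (F R) + (tail_const X1 / (R / 4)\<^sup>2 + tail_const X2 / (R / 4)\<^sup>2)) at_top"
        using R by (intro tendsto_add lim right_tailD right_tail_tail_const X) auto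
      show "\<forall>\<^sub>F s in at_top. b s * prob {w \<in> space M. \<bar>a * X1 w + c * X2 w\<bar> > s * v} \<le>
         b s * expectation (\<lambda>w. F R (?X s w)) + (b s * prob {w \<in> space M. \<bar>X1 w\<bar> > s * (R / 4)}
         + b s * prob {w \<in> space M. \<bar>X2 w\<bar> > s * (R / 4)})"
        using eventually_gt_at_top[of 0]
      proof eventually_elim
        case (elim s)
        \<comment> \<open>Here \<open>F R\<close> may be cut off. The weight of this event is
          controlled by \<open>prob_norm_ge_le\<close>, whence R/4.\<close>
        let ?B = "{w \<in> space M. norm (?X s w) \<ge> R}"
        have "expectation (indicator {w \<in> space M. \<bar>a * X1 w + c * X2 w\<bar> > s * v})
          \<le> expectation (\<lambda>w. F R (?X s w) + indicator ?B w)"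
        proof (rule integral_mono)
          fix w assume w: "w \<in> space M"
          show "indicator {w \<in> space M. \<bar>a * X1 w + c * X2 w\<bar> > s * v} w \<le> F R (?X s w) + indicator ?B w"
          proof (cases "\<bar>a * X1 w + c * X2 w\<bar> > s * v \<and> w \<notin> ?B")
            case True
            then have "F R (?X s w) = 1"
              using elim w by (intro Fv) (auto simp: ls field_simps)
            then show ?thesis using w True by simp
          next
            case False
            then show ?thesis using F01(1)[of R "?X s w"] w by (auto simp: indicator_def)
          qed
        qed (auto intro!: Bochner_Integration.integrable_add Fint simp: less_top[symmetric])
        also have "\<dots> = expectation (\<lambda>w. F R (?X s w)) + prob ?B"
          by (subst Bochner_Integration.integral_add) (auto intro!: Fint simp: less_top[symmetric])
        also have "\<dots> \<le> expectation (\<lambda>w. F R (?X s w)) +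
           (prob {w \<in> space M. \<bar>X1 w\<bar> > s * (R / 4)} + prob {w \<in> space M. \<bar>X2 w\<bar> > s * (R / 4)})"
          by (intro add_left_mono prob_norm_ge_le elim R) measurable
        finally have "prob {w \<in> space M. \<bar>a * X1 w + c * X2 w\<bar> > s * v} \<le> expectation (\<lambda>w. F R (?X s w)) +
           (prob {w \<in> space M. \<bar>X1 w\<bar> > s * (R / 4)} + prob {w \<in> space M. \<bar>X2 w\<bar> > s * (R / 4)})" by simp
        then show ?case
          using b_pos[OF elim] by (simp add: distrib_left[symmetric] mult_left_mono)
      qed
    qed (use u in simp)
    with Fm_le[of R] show ?thesis by (simp add: add_divide_distrib)
  qed
  \<comment> \<open>R is arbitrary and the error is of order R^-2; the factor 16 below comes from
    the square of R/4.\<close>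
  have "q / v\<^sup>2 \<le> m + 0"
  proof (rule tendsto_le[OF trivial_limit_at_top_linorder _ tendsto_const])
    show "((\<lambda>R. m + (tail_const X1 + tail_const X2) * 16 * (inverse R * inverse R)) \<longlongrightarrow> m + 0) at_top"
      by (intro tendsto_add tendsto_const tendsto_mult_right_zero tendsto_mult_zero tendsto_inverse_0_at_top filterlim_ident)
    show "\<forall>\<^sub>F R in at_top. q / v\<^sup>2 \<le> m + (tail_const X1 + tail_const X2) * 16 * (inverse R * inverse R)"
      using eventually_gt_at_top[of 0]
    proof eventually_elim
      case (elim R)
      from low[OF elim] elim show ?case by (simp add: power2_eq_square field_simps)
    qed
  qed
  then show "q / v\<^sup>2 \<le> measure N {x. \<bar>a * fst x + c * snd x\<bar> > u}" by (simp add: m_def l_def)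
qed

text \<open>Homogeneity relates the regions at levels 1 and v, so the mass at level 1 is squeezed
  between q/v^2 and q v^2 while v decreases to 1. This takes the place of a proof that the boundary
  |a x1 + c x2| = 1 is null.\<close>

lemma planar_tail_linear:
  fixes a c :: real
  assumes N: "planar_tail X1 X2 N" and X: "X1 \<in> V_space M b" "X2 \<in> V_space M b"
    and q: "right_tail (\<lambda>w. \<bar>a * X1 w + c * X2 w\<bar>) q"
  shows "emeasure N {x. \<bar>a * fst x + c * snd x\<bar> > 1} = ennreal q"
proof -
  interpret punctured_measure N using N by (simp add: planar_tail_def)
  define A where "A t = {x :: real \<times> real. \<bar>a * fst x + c * snd x\<bar> > t}" for t
  note bnd = planar_tail_linear_bounds[OF N X q, folded A_def]
  have fin: "emeasure N (A u) < \<infinity>" if "u > 0" for u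
    using bnd(2)[of u "u + 1"] that by simp
  have A1: "A 1 \<in> sets borel"
    unfolding A_def by (intro borel_open open_Collect_less continuous_intros)
  have hom: "measure N (A 1) = v\<^sup>2 * measure N (A v)" if v: "v > 0" for v
  proof -
    have "{x. x /\<^sub>R v \<in> A 1} = A v"
    proof -
      have "a * (fst x / v) + c * (snd x / v) = (a * fst x + c * snd x) / v" for x :: "real \<times> real"
        by (simp add: add_divide_distrib)
      then show ?thesis
        using v by (auto simp: A_def divide_inverse_commute[symmetric] pos_less_divide_eq)
    qed
    with planar_tail_homogeneous[OF N v A1] have "emeasure N (A 1) = ennreal (v\<^sup>2) * emeasure N (A v)" by simp
    then show ?thesis using v by (simp add: measure_def enn2real_mult)
  qed
  define m where "m = measure N (A 1)"
  have q0: "q \<ge> 0" by (rule right_tail_nonneg[OF q])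
  have qm: "q \<le> m * v\<^sup>2" and mq: "m \<le> q * v\<^sup>2" if v: "v > 1" for v
  proof -
    show "q \<le> m * v\<^sup>2" using bnd(3)[of 1 v] v by (simp add: m_def pos_divide_le_eq)
    have "ennreal (measure N (A v)) \<le> ennreal q"
      using bnd(1)[of 1 v] fin[of v] v by (simp add: emeasure_eq_ennreal_measure less_top)
    then have "measure N (A v) \<le> q" using q0 by (simp add: ennreal_le_iff)
    then have "v\<^sup>2 * measure N (A v) \<le> v\<^sup>2 * q" by (intro mult_left_mono) auto
    then show "m \<le> q * v\<^sup>2" using hom[of v] v by (simp add: m_def mult.commute)
  qed
  have lim: "((\<lambda>v. k * v\<^sup>2) \<longlongrightarrow> k * 1\<^sup>2) (at_right (1::real))" for k
    by (intro tendsto_intros)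
  have ev: "\<forall>\<^sub>F v in at_right (1::real). v > 1" by (simp add: eventually_at_right_less)
  have "q \<le> m * 1\<^sup>2"
    by (rule tendsto_le[OF _ lim tendsto_const]) (use ev qm in \<open>auto elim: eventually_mono\<close>)
  moreover have "m \<le> q * 1\<^sup>2"
    by (rule tendsto_le[OF _ lim tendsto_const]) (use ev mq in \<open>auto elim: eventually_mono\<close>)
  ultimately have "m = q" by simp
  then show ?thesis
    using fin[of 1] by (simp add: emeasure_eq_ennreal_measure less_top m_def A_def)
qed

section \<open>Independence of the choice of representatives\<close>

lemma N_space_tail: "X \<in> N_space M b \<Longrightarrow> right_tail (\<lambda>w. \<bar>X w\<bar>) 0"
  by (simp add: N_space_iff)

text \<open>Because of the factor \<open>b s\<close>, a uniformly small difference of the integrands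
  does not suffice by itself. Where both arguments lie in the e-ball the difference is 0, and the
  weighted probability of the complement stays bounded. Where the arguments are at least d apart,
  boundedness of \<open>G\<close> is enough, since that event has weight tending to 0.\<close>

lemma expectation_perturb_null:
  fixes G :: "real \<times> real \<Rightarrow> real"
  assumes X: "X1 \<in> V_space M b" "X2 \<in> V_space M b" and Y: "Y1 \<in> V_space M b" "Y2 \<in> V_space M b"
    and D: "(\<lambda>w. X1 w - Y1 w) \<in> N_space M b" "(\<lambda>w. X2 w - Y2 w) \<in> N_space M b"
    and uc: "uniformly_continuous_on UNIV G" and B: "\<And>x. \<bar>G x\<bar> \<le> B"
    and e: "e > 0" "\<And>x. norm x < e \<Longrightarrow> G x = 0"
  shows "((\<lambda>s. b s * expectation (\<lambda>w. G (Y1 w / s, Y2 w / s)) - b s * expectation (\<lambda>w. G (X1 w / s, X2 w / s))) \<longlongrightarrow> 0) at_top"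
proof (rule tendstoI)
  fix eps :: real assume eps: "eps > 0"
  note [measurable] = X[THEN V_space_measurable] Y[THEN V_space_measurable]
  have Gm[measurable]: "G \<in> borel_measurable borel"
    by (intro borel_measurable_continuous_onI uniformly_continuous_imp_continuous uc)
  let ?X = "\<lambda>s w. (X1 w / s, X2 w / s)" and ?Y = "\<lambda>s w. (Y1 w / s, Y2 w / s)"
  let ?D = "\<lambda>s w. ((X1 w - Y1 w) / s, (X2 w - Y2 w) / s)"
  have [measurable]: "?X s \<in> borel_measurable M" "?Y s \<in> borel_measurable M" "?D s \<in> borel_measurable M" for s
    by (rule measurable_scaled_pair; measurable)+
  \<comment> \<open>A bound, in the limit, for b(s) times the probability that either vector leaves
    the e-ball.\<close>
  define K where "K = (tail_const X1 + tail_const X2 + tail_const Y1 + tail_const Y2) / (e / 4)\<^sup>2"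
  have K: "K \<ge> 0" unfolding K_def by (intro divide_nonneg_nonneg add_nonneg_nonneg tail_const_nonneg X Y) auto
  \<comment> \<open>Chosen so that \<eta> K < eps; the summand 1 keeps the denominator
    positive.\<close>
  define \<eta> where "\<eta> = eps / (K + 1)"
  have eta: "\<eta> > 0" "\<eta> * K < eps"
    using eps K by (auto simp: \<eta>_def pos_divide_less_eq algebra_simps)
  obtain d where d: "d > 0" "\<And>x y. dist y x < d \<Longrightarrow> dist (G y) (G x) < \<eta>"
    using uc eta(1) unfolding uniformly_continuous_on_def by (metis UNIV_I)
  define T where "T Z1 Z2 r s = prob {w \<in> space M. \<bar>Z1 w :: real\<bar> > s * (r / 4)} + prob {w \<in> space M. \<bar>Z2 w :: real\<bar> > s * (r / 4)}"
    for Z1 Z2 r s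
  have limT: "((\<lambda>s. b s * T Z1 Z2 r s) \<longlongrightarrow> (z1 + z2) / (r / 4)\<^sup>2) at_top"
    if "right_tail (\<lambda>w. \<bar>Z1 w\<bar>) z1" "right_tail (\<lambda>w. \<bar>Z2 w\<bar>) z2" "r > 0" for Z1 Z2 z1 z2 r
    unfolding T_def distrib_left add_divide_distrib
    using that(3) by (intro tendsto_add right_tailD[OF that(1)] right_tailD[OF that(2)]) auto
  have "((\<lambda>s. \<eta> * (b s * T X1 X2 e s + b s * T Y1 Y2 e s) + 2 * B * (b s * T (\<lambda>w. X1 w - Y1 w) (\<lambda>w. X2 w - Y2 w) d s))
     \<longlongrightarrow> \<eta> * ((tail_const X1 + tail_const X2) / (e / 4)\<^sup>2 + (tail_const Y1 + tail_const Y2) / (e / 4)\<^sup>2) + 2 * B * ((0 + 0) / (d / 4)\<^sup>2)) at_top"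
    by (intro tendsto_add tendsto_mult tendsto_const limT right_tail_tail_const X Y N_space_tail D e d)
  also have "\<eta> * ((tail_const X1 + tail_const X2) / (e / 4)\<^sup>2 + (tail_const Y1 + tail_const Y2) / (e / 4)\<^sup>2) + 2 * B * ((0 + 0) / (d / 4)\<^sup>2) = \<eta> * K"
    by (simp add: K_def add_divide_distrib)
  finally have "\<forall>\<^sub>F s in at_top. \<eta> * (b s * T X1 X2 e s + b s * T Y1 Y2 e s)
      + 2 * B * (b s * T (\<lambda>w. X1 w - Y1 w) (\<lambda>w. X2 w - Y2 w) d s) < eps"
    using eta(2) by (auto dest: order_tendstoD)
  then show "\<forall>\<^sub>F s in at_top. dist (b s * expectation (\<lambda>w. G (?Y s w)) - b s * expectation (\<lambda>w. G (?X s w))) 0 < eps"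
    using eventually_gt_at_top[of 0]
  proof eventually_elim
    case (elim s)
    let ?EX = "{w \<in> space M. norm (?X s w) \<ge> e}" and ?EY = "{w \<in> space M. norm (?Y s w) \<ge> e}"
      and ?ED = "{w \<in> space M. norm (?D s w) \<ge> d}"
    have B0: "B \<ge> 0" using B[of 0] by linarith
    have int: "integrable M (\<lambda>w. G (?X s w))" "integrable M (\<lambda>w. G (?Y s w))"
      by (rule integrable_const_bound[where B = B]; use B in simp)+
    have pt: "\<bar>G (?Y s w) - G (?X s w)\<bar> \<le> \<eta> * (indicator ?EX w + indicator ?EY w) + 2 * B * indicator ?ED w"
      if w: "w \<in> space M" for w
    proof -
      have nn: "0 \<le> \<eta> * (indicator ?EX w + indicator ?EY w)" "0 \<le> 2 * B * (indicator ?ED w :: real)"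
        using eta(1) B0 by simp_all
      show ?thesis
      proof (cases "w \<in> ?ED")
        case True
        have "\<bar>G (?Y s w) - G (?X s w)\<bar> \<le> 2 * B"
          using B[of "?Y s w"] B[of "?X s w"] by linarith
        then show ?thesis using True nn by simp
      next
        case False
        have "dist (?Y s w) (?X s w) = norm (?D s w)"
          unfolding dist_commute[of "?Y s w"] by (simp add: dist_norm diff_divide_distrib)
        with False w have "dist (?Y s w) (?X s w) < d" by simp
        from d(2)[OF this] have lt: "\<bar>G (?Y s w) - G (?X s w)\<bar> < \<eta>" by (simp add: dist_real_def)
        show ?thesis
        proof (cases "w \<in> ?EX \<or> w \<in> ?EY")
          case True
          then have "1 \<le> indicator ?EX w + (indicator ?EY w :: real)" by (auto simp: indicator_def)
          then have "\<eta> * 1 \<le> \<eta> * (indicator ?EX w + indicator ?EY w)"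
            using eta(1) by (intro mult_left_mono) auto
          with lt nn show ?thesis by linarith
        next
          case False
          then have "G (?X s w) = 0" "G (?Y s w) = 0" using w e(2) by auto
          then show ?thesis using nn by linarith
        qed
      qed
    qed
    have "\<bar>expectation (\<lambda>w. G (?Y s w)) - expectation (\<lambda>w. G (?X s w))\<bar> = \<bar>expectation (\<lambda>w. G (?Y s w) - G (?X s w))\<bar>"
      using int by simp
    also have "\<dots> \<le> expectation (\<lambda>w. \<bar>G (?Y s w) - G (?X s w)\<bar>)"
      by (rule integral_abs_bound)
    also have "\<dots> \<le> expectation (\<lambda>w. \<eta> * (indicator ?EX w + indicator ?EY w) + 2 * B * indicator ?ED w)"
      by (rule integral_mono) (use int pt in \<open>auto simp: less_top[symmetric]\<close>)
    also have "\<dots> = \<eta> * (prob ?EX + prob ?EY) + 2 * B * prob ?ED"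
      by (simp add: less_top[symmetric])
    also have "\<dots> \<le> \<eta> * (T X1 X2 e s + T Y1 Y2 e s) + 2 * B * T (\<lambda>w. X1 w - Y1 w) (\<lambda>w. X2 w - Y2 w) d s"
      unfolding T_def using eta(1) B0
      by (intro add_mono mult_left_mono prob_norm_ge_le elim(2) e(1) d(1)) auto
    finally have "b s * \<bar>expectation (\<lambda>w. G (?Y s w)) - expectation (\<lambda>w. G (?X s w))\<bar>
      \<le> b s * (\<eta> * (T X1 X2 e s + T Y1 Y2 e s) + 2 * B * T (\<lambda>w. X1 w - Y1 w) (\<lambda>w. X2 w - Y2 w) d s)"
      using b_pos[OF elim(2)] by (intro mult_left_mono) auto
    also have "\<dots> < eps" using elim(1) by (simp add: algebra_simps)
    finally show ?case
      using b_pos[OF elim(2)] by (simp add: abs_mult right_diff_distrib[symmetric])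
  qed
qed

text \<open>The hypothesis on the subspace yields a tail measure for one pair of representatives.
  Here the very same measure is carried to any other pair, by comparing test integrals through
  \<open>expectation_perturb_null\<close>.\<close>

lemma is_tail_measure_perturb:
  assumes nu: "is_tail_measure M b X1 X2 \<nu>"
    and X: "X1 \<in> V_space M b" "X2 \<in> V_space M b" and Y: "Y1 \<in> V_space M b" "Y2 \<in> V_space M b"
    and D: "(\<lambda>w. X1 w - Y1 w) \<in> N_space M b" "(\<lambda>w. X2 w - Y2 w) \<in> N_space M b"
  shows "is_tail_measure M b Y1 Y2 \<nu>"
proof -
  have "vaguely_converges_on punctured_plane (scaled_law M b Y1 Y2) \<nu> at_top"
    unfolding vaguely_converges_on_def
  proof (intro allI impI, elim conjE exE)
    fix f :: "ereal \<times> ereal \<Rightarrow> real" and K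
    assume f: "continuous_on punctured_plane f" and K: "compact K" "K \<subseteq> punctured_plane" "\<forall>x\<in>punctured_plane - K. f x = 0"
    define g where "g x = (if x \<in> punctured_plane then f x else 0)" for x
    note tf = test_function_props[OF f K, folded g_def]
    obtain B where B: "\<And>x. \<bar>g x\<bar> \<le> B" using tf(2) by blast
    obtain e where e: "e > 0" "\<And>x. norm x < e \<Longrightarrow> g (embed_plane x) = 0" using tf(3) by blast
    have lim: "((\<lambda>s. integral\<^sup>L (scaled_law M b X1 X2 s) f) \<longlongrightarrow> integral\<^sup>L \<nu> f) at_top"
      using nu f K unfolding is_tail_measure_def vaguely_converges_on_def by blast
    have "((\<lambda>s. b s * expectation (\<lambda>w. g (embed_plane (Y1 w / s, Y2 w / s))) - b s * expectation (\<lambda>w. g (embed_plane (X1 w / s, X2 w / s)))) \<longlongrightarrow> 0) at_top"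
      by (rule expectation_perturb_null[OF X Y D uniformly_continuous_embed_plane[OF tf(1)] B e])
    from tendsto_add[OF this lim]
    have "((\<lambda>s. b s * expectation (\<lambda>w. g (embed_plane (Y1 w / s, Y2 w / s))) - b s * expectation (\<lambda>w. g (embed_plane (X1 w / s, X2 w / s)))
       + integral\<^sup>L (scaled_law M b X1 X2 s) f) \<longlongrightarrow> integral\<^sup>L \<nu> f) at_top" by simp
    then show "((\<lambda>s. integral\<^sup>L (scaled_law M b Y1 Y2 s) f) \<longlongrightarrow> integral\<^sup>L \<nu> f) at_top"
    proof (rule Lim_transform_eventually)
      show "\<forall>\<^sub>F s in at_top. b s * expectation (\<lambda>w. g (embed_plane (Y1 w / s, Y2 w / s))) - b s * expectation (\<lambda>w. g (embed_plane (X1 w / s, X2 w / s)))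
       + integral\<^sup>L (scaled_law M b X1 X2 s) f = integral\<^sup>L (scaled_law M b Y1 Y2 s) f"
        using eventually_gt_at_top[of 0]
        by eventually_elim
          (simp add: integral_scaled_law[OF V_space_measurable[OF X(1)] V_space_measurable[OF X(2)] tf(1) g_def]
             integral_scaled_law[OF V_space_measurable[OF Y(1)] V_space_measurable[OF Y(2)] tf(1) g_def])
    qed
  qed
  with nu show ?thesis by (simp add: is_tail_measure_def)
qed

section \<open>Polar coordinates and the quadratic form of a pair\<close>

lemma emeasure_cone:
  assumes N: "planar_tail X1 X2 N" and B: "B \<in> sets (angular_of N)" and r: "r > 0"
  shows "emeasure N {x. norm x > r \<and> x /\<^sub>R norm x \<in> B} = ennreal (1 / r\<^sup>2) * emeasure (angular_of N) B"
proof -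
  interpret punctured_measure N using N by (simp add: planar_tail_def)
  have Bb: "B \<in> sets borel" using B by (simp add: sets_angular_of in_sets_circle)
  \<comment> \<open>The cone beyond radius r is r times the cone beyond radius 1, since directions
    are invariant under scaling.\<close>
  have "{x. x /\<^sub>R r \<in> {x. norm x > 1 \<and> x /\<^sub>R norm x \<in> B}} = {x. norm x > r \<and> x /\<^sub>R norm x \<in> B}"
  proof -
    have "norm (x /\<^sub>R r) > 1 \<longleftrightarrow> norm x > r" "x /\<^sub>R r /\<^sub>R norm (x /\<^sub>R r) = x /\<^sub>R norm x" for x :: "real \<times> real"
      using r by (simp_all add: field_simps)
    then show ?thesis by (simp only: mem_Collect_eq)
  qed
  with planar_tail_homogeneous[OF N r cone_sets[OF Bb, of 1]] emeasure_angular_of[OF sets_N B]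
  have "emeasure (angular_of N) B = ennreal (r\<^sup>2) * emeasure N {x. norm x > r \<and> x /\<^sub>R norm x \<in> B}" by simp
  then show ?thesis by (simp add: ennreal_inverse_square_cancel[OF r])
qed

text \<open>At r = 1 the defining identity already fixes H on every Borel subset of the circle,
  hence uniqueness; existence is the cone formula.\<close>

lemma angular_measure_unique:
  assumes X: "X1 \<in> borel_measurable M" "X2 \<in> borel_measurable M"
    and nu: "is_tail_measure M b X1 X2 \<nu>"
  shows "(THE H. is_angular_measure 2 (tail_measure M b X1 X2) H) = angular_of (planar \<nu>)"
proof (rule the_equality)
  interpret p: plane_measure \<nu> by (rule plane_measure_tail[OF nu])
  have N: "planar_tail X1 X2 (planar \<nu>)" by (rule planar_tail_planar[OF X nu])
  have nu_cone: "emeasure \<nu> (embed_plane ` {x. norm x > r \<and> x /\<^sub>R norm x \<in> B}) = emeasure (planar \<nu>) {x. norm x > r \<and> x /\<^sub>R norm x \<in> B}"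
    if "B \<in> sets borel" "r > 0" for B r
    using that by (intro p.emeasure_planar cone_sets) auto
  note eq = tail_measure_eq[OF X nu]
  show ang: "is_angular_measure 2 (tail_measure M b X1 X2) (angular_of (planar \<nu>))"
    unfolding is_angular_measure_def eq
  proof (intro conjI allI impI ballI)
    show "finite_measure (angular_of (planar \<nu>))"
      using N by (intro finite_angular_of) (simp add: planar_tail_def)
    fix r :: real and B assume r: "r > 0" and B: "B \<in> sets (angular_of (planar \<nu>))"
    then have "B \<in> sets borel" by (simp add: sets_angular_of in_sets_circle)
    then show "emeasure \<nu> (embed_plane ` {x. norm x > r \<and> x /\<^sub>R norm x \<in> B}) = ennreal (r powr (- 2)) * emeasure (angular_of (planar \<nu>)) B"
      using r by (simp add: nu_cone emeasure_cone[OF N B r] powr_minus powr_numeral divide_inverse)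
  qed (rule sets_angular_of)
  fix H assume H: "is_angular_measure 2 (tail_measure M b X1 X2) H"
  show "H = angular_of (planar \<nu>)"
  proof (rule measure_eqI)
    show s: "sets H = sets (angular_of (planar \<nu>))"
      using H by (simp add: is_angular_measure_def sets_angular_of)
    fix B assume B: "B \<in> sets H"
    have "emeasure \<nu> (embed_plane ` {x. norm x > 1 \<and> x /\<^sub>R norm x \<in> B}) = ennreal (1 powr (- 2)) * emeasure H B"
      using H B unfolding is_angular_measure_def eq using zero_less_one by blast
    moreover have "emeasure \<nu> (embed_plane ` {x. norm x > 1 \<and> x /\<^sub>R norm x \<in> B}) = ennreal (1 powr (- 2)) * emeasure (angular_of (planar \<nu>)) B"
      using ang B s unfolding is_angular_measure_def eq using zero_less_one by blast
    ultimately show "emeasure H B = emeasure (angular_of (planar \<nu>)) B" by simp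
  qed
qed

text \<open>Polar coordinates: the radial part of \<open>N\<close> has tail \<open>r\<^sup>-\<^sup>2\<close>, so the region \<open>r\<^sup>2 h(\<omega>) > 1\<close>
  has mass \<open>h(\<omega>)\<close> on the ray in direction \<open>\<omega>\<close>.\<close>

lemma nn_integral_angular_of:
  assumes N: "planar_tail X1 X2 N" and h: "h \<in> borel_measurable (angular_of N)"
  shows "(\<integral>\<^sup>+\<omega>. h \<omega> \<partial>angular_of N) = emeasure N {x. x \<noteq> 0 \<and> 1 < ennreal ((norm x)\<^sup>2) * h (x /\<^sub>R norm x)}"
proof -
  interpret punctured_measure N using N by (simp add: planar_tail_def)
  let ?H = "angular_of N"
  define R where "R h = {x :: real \<times> real. x \<noteq> 0 \<and> 1 < ennreal ((norm x)\<^sup>2) * h (x /\<^sub>R norm x)}" for h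
  obtain f where f: "\<And>i. simple_function ?H (f i)" "incseq f" "\<And>i x. f i x < top" "\<And>x. (SUP i. f i x) = h x"
    using borel_measurable_implies_simple_function_sequence'[OF h] by metis
  have circle: "x /\<^sub>R norm x \<in> space ?H" if "x \<noteq> 0" for x :: "real \<times> real"
    using that by (simp add: space_angular_of)
  \<comment> \<open>The part of the region over B where the integrand is constantly y. For y > 0 it
    is the cone over B beyond radius 1/sqrt y, of mass y times the angular mass of B.\<close>
  define P where "P y B = {x :: real \<times> real. x \<noteq> 0 \<and> x /\<^sub>R norm x \<in> B \<and> 1 < ennreal ((norm x)\<^sup>2) * y}" for y B
  have piece: "P y B \<in> sets N \<and> emeasure N (P y B) = y * emeasure ?H B" if B: "B \<in> sets ?H" and y: "y < top" for y B
  proof (cases "y = 0")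
    case True
    then show ?thesis by (simp add: P_def)
  next
    case False
    then obtain r where r: "y = ennreal r" "r > 0"
      using y by (cases y) (auto simp: ennreal_eq_0_iff less_le)
    have "P y B = {x. norm x > 1 / sqrt r \<and> x /\<^sub>R norm x \<in> B}"
    proof -
      have "x \<noteq> 0 \<and> 1 < ennreal ((norm x)\<^sup>2) * y \<longleftrightarrow> norm x > 1 / sqrt r" for x :: "real \<times> real"
      proof -
        have "1 < ennreal ((norm x)\<^sup>2) * y \<longleftrightarrow> 1 < (norm x)\<^sup>2 * r"
          using r by (simp add: ennreal_mult''[symmetric] ennreal_less_iff flip: ennreal_1)
        also have "\<dots> \<longleftrightarrow> 1\<^sup>2 < (norm x * sqrt r)\<^sup>2"
          using r by (simp add: power_mult_distrib)
        also have "\<dots> \<longleftrightarrow> 1 < norm x * sqrt r"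
          using r power_strict_mono[of 1 "norm x * sqrt r" 2] power_less_imp_less_base[of 1 2 "norm x * sqrt r"] by auto
        also have "\<dots> \<longleftrightarrow> norm x > 1 / sqrt r"
          using r by (simp add: pos_divide_less_eq)
        finally show ?thesis using r by auto
      qed
      then show ?thesis by (auto simp: P_def)
    qed
    moreover have "B \<in> sets borel" using B by (simp add: sets_angular_of in_sets_circle)
    ultimately show ?thesis
      using r emeasure_cone[OF N B, of "1 / sqrt r"] cone_sets[of B "1 / sqrt r"]
      by (simp add: power_divide)
  qed
  have simple: "R (f i) \<in> sets N \<and> emeasure N (R (f i)) = (\<integral>\<^sup>+\<omega>. f i \<omega> \<partial>?H)" for i
  proof -
    have fin: "finite (f i ` space ?H)" and B: "\<And>y. f i -` {y} \<inter> space ?H \<in> sets ?H"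
      using simple_functionD[OF f(1)[of i]] by auto
    \<comment> \<open>Sorting points by the value of \<open>f i\<close> in their direction makes the
      region a finite disjoint union of such pieces.\<close>
    have Rf: "R (f i) = (\<Union>y\<in>f i ` space ?H. P y (f i -` {y} \<inter> space ?H))"
    proof (intro set_eqI iffI)
      fix x assume x: "x \<in> R (f i)"
      then have c: "x /\<^sub>R norm x \<in> space ?H" by (intro circle) (simp add: R_def)
      with x have "x \<in> P (f i (x /\<^sub>R norm x)) (f i -` {f i (x /\<^sub>R norm x)} \<inter> space ?H)"
        by (simp add: R_def P_def)
      then show "x \<in> (\<Union>y\<in>f i ` space ?H. P y (f i -` {y} \<inter> space ?H))"
        using imageI[OF c] by (rule UN_I[rotated])
    qed (auto simp: R_def P_def)
    have Ps: "P y (f i -` {y} \<inter> space ?H) \<in> sets N" "emeasure N (P y (f i -` {y} \<inter> space ?H)) = y * emeasure ?H (f i -` {y} \<inter> space ?H)"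
      if "y \<in> f i ` space ?H" for y
    proof -
      have "y < top" using that f(3) by auto
      from piece[OF B this] show "P y (f i -` {y} \<inter> space ?H) \<in> sets N" "emeasure N (P y (f i -` {y} \<inter> space ?H)) = y * emeasure ?H (f i -` {y} \<inter> space ?H)"
        by auto
    qed
    have "emeasure N (R (f i)) = (\<Sum>y\<in>f i ` space ?H. emeasure N (P y (f i -` {y} \<inter> space ?H)))"
      unfolding Rf
    proof (rule sum_emeasure[symmetric])
      show "disjoint_family_on (\<lambda>y. P y (f i -` {y} \<inter> space ?H)) (f i ` space ?H)"
        by (auto simp: disjoint_family_on_def P_def)
    qed (use Ps(1) fin in auto)
    also have "\<dots> = (\<Sum>y\<in>f i ` space ?H. y * emeasure ?H (f i -` {y} \<inter> space ?H))"
      by (intro sum.cong refl Ps(2))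
    also have "\<dots> = (\<integral>\<^sup>+\<omega>. f i \<omega> \<partial>?H)"
      unfolding nn_integral_eq_simple_integral[OF f(1)] simple_integral_def ..
    finally have "emeasure N (R (f i)) = (\<integral>\<^sup>+\<omega>. f i \<omega> \<partial>?H)" .
    moreover have "R (f i) \<in> sets N"
      unfolding Rf using fin Ps(1) by (intro sets.finite_UN) auto
    ultimately show ?thesis by blast
  qed
  have "(\<integral>\<^sup>+\<omega>. h \<omega> \<partial>?H) = (\<integral>\<^sup>+\<omega>. (SUP i. f i \<omega>) \<partial>?H)" by (simp add: f(4))
  also have "\<dots> = (SUP i. \<integral>\<^sup>+\<omega>. f i \<omega> \<partial>?H)"
    by (intro nn_integral_monotone_convergence_SUP f(2) borel_measurable_simple_function f(1))
  also have "\<dots> = (SUP i. emeasure N (R (f i)))" by (simp add: simple)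
  also have "\<dots> = emeasure N (\<Union>i. R (f i))"
  proof (rule SUP_emeasure_incseq)
    show "incseq (\<lambda>i. R (f i))"
    proof (rule incseq_SucI, rule subsetI)
      fix i x assume "x \<in> R (f i)"
      then have x: "x \<noteq> 0" "1 < ennreal ((norm x)\<^sup>2) * f i (x /\<^sub>R norm x)" by (auto simp: R_def)
      have "f i (x /\<^sub>R norm x) \<le> f (Suc i) (x /\<^sub>R norm x)"
        using incseq_SucD[OF f(2)] by (simp add: le_fun_def)
      then have "ennreal ((norm x)\<^sup>2) * f i (x /\<^sub>R norm x) \<le> ennreal ((norm x)\<^sup>2) * f (Suc i) (x /\<^sub>R norm x)"
        by (intro mult_left_mono) auto
      with x show "x \<in> R (f (Suc i))" by (simp add: R_def)
    qed
  qed (use simple in auto)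
  \<comment> \<open>Strictness of the inequality matters: a supremum exceeds 1 exactly when one of
    its terms does.\<close>
  also have "(\<Union>i. R (f i)) = R h"
    by (auto simp: R_def f(4)[symmetric] SUP_mult_left_ennreal less_SUP_iff)
  finally show ?thesis by (simp add: R_def)
qed

text \<open>In polar coordinates |a x1 + c x2| > 1 reads r^2 h(\<omega>) > 1 with h the square of a
  linear form. The exponent of that form is the index; its being 2 is what makes the integral a
  quadratic polynomial in \<open>a\<close> and \<open>c\<close>.\<close>

lemma tail_const_quadratic:
  fixes a c :: real
  assumes nu: "is_tail_measure M b X1 X2 \<nu>" and X: "X1 \<in> V_space M b" "X2 \<in> V_space M b"
    and V: "(\<lambda>w. a * X1 w + c * X2 w) \<in> V_space M b"
  defines "H \<equiv> angular_of (planar \<nu>)"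
  shows "tail_const (\<lambda>w. a * X1 w + c * X2 w) =
    a\<^sup>2 * (\<integral>\<omega>. (fst \<omega>)\<^sup>2 \<partial>H) + 2 * a * c * (\<integral>\<omega>. fst \<omega> * snd \<omega> \<partial>H) + c\<^sup>2 * (\<integral>\<omega>. (snd \<omega>)\<^sup>2 \<partial>H)"
proof -
  let ?q = "tail_const (\<lambda>w. a * X1 w + c * X2 w)"
  have N: "planar_tail X1 X2 (planar \<nu>)" by (rule planar_tail_planar[OF X[THEN V_space_measurable] nu])
  interpret H: finite_measure H
    unfolding H_def using N by (intro finite_angular_of) (simp add: planar_tail_def)
  have borel_H: "f \<in> borel_measurable H" if "f \<in> borel_measurable borel" for f :: "real \<times> real \<Rightarrow> real"
    unfolding H_def measurable_cong_sets[OF sets_angular_of refl] by (rule measurable_restrict_space1[OF that])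
  have bounds: "\<bar>fst \<omega>\<bar> \<le> 1" "\<bar>snd \<omega>\<bar> \<le> 1" if "\<omega> \<in> space H" for \<omega>
    using that norm_fst_le[of "fst \<omega>" "snd \<omega>"] norm_snd_le[of "snd \<omega>" "fst \<omega>"]
    by (auto simp: H_def space_angular_of)
  have int: "integrable H (\<lambda>\<omega>. f \<omega> * g \<omega>)"
    if "f \<in> {fst, snd}" "g \<in> {fst, snd}" for f g :: "real \<times> real \<Rightarrow> real"
  proof (rule H.integrable_const_bound[where B = 1])
    show "AE \<omega> in H. norm (f \<omega> * g \<omega>) \<le> 1"
    proof (rule AE_I2)
      fix \<omega> assume "\<omega> \<in> space H"
      from that bounds[OF this] have "\<bar>f \<omega>\<bar> \<le> 1" "\<bar>g \<omega>\<bar> \<le> 1" by auto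
      then show "norm (f \<omega> * g \<omega>) \<le> 1" by (simp add: abs_mult mult_le_one)
    qed
    have "f \<in> borel_measurable borel" "g \<in> borel_measurable borel"
      using that by (auto intro!: borel_measurable_continuous_onI continuous_intros)
    then show "(\<lambda>\<omega>. f \<omega> * g \<omega>) \<in> borel_measurable H"
      by (intro borel_H borel_measurable_times)
  qed
  have hm: "(\<lambda>\<omega>. (a * fst \<omega> + c * snd \<omega>)\<^sup>2) \<in> borel_measurable H"
    by (intro borel_H borel_measurable_continuous_onI continuous_intros)
  have "(\<integral>\<^sup>+\<omega>. ennreal ((a * fst \<omega> + c * snd \<omega>)\<^sup>2) \<partial>H)
    = emeasure (planar \<nu>) {x. x \<noteq> 0 \<and> 1 < ennreal ((norm x)\<^sup>2) * ennreal ((a * fst (x /\<^sub>R norm x) + c * snd (x /\<^sub>R norm x))\<^sup>2)}"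
    using hm unfolding H_def by (intro nn_integral_angular_of[OF N]) simp
  also have "{x. x \<noteq> 0 \<and> 1 < ennreal ((norm x)\<^sup>2) * ennreal ((a * fst (x /\<^sub>R norm x) + c * snd (x /\<^sub>R norm x))\<^sup>2)}
     = {x. \<bar>a * fst x + c * snd x\<bar> > 1}"
  proof -
    have "x \<noteq> 0 \<and> 1 < ennreal ((norm x)\<^sup>2) * ennreal ((a * fst (x /\<^sub>R norm x) + c * snd (x /\<^sub>R norm x))\<^sup>2)
       \<longleftrightarrow> \<bar>a * fst x + c * snd x\<bar> > 1" for x :: "real \<times> real"
    proof (cases "x = 0")
      case False
      have "(norm x)\<^sup>2 * (a * fst (x /\<^sub>R norm x) + c * snd (x /\<^sub>R norm x))\<^sup>2 = (norm x * (a * fst (x /\<^sub>R norm x) + c * snd (x /\<^sub>R norm x)))\<^sup>2"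
        by (simp add: power_mult_distrib)
      also have "norm x * (a * fst (x /\<^sub>R norm x) + c * snd (x /\<^sub>R norm x)) = a * fst x + c * snd x"
        using False by (simp add: field_simps)
      finally have "ennreal ((norm x)\<^sup>2) * ennreal ((a * fst (x /\<^sub>R norm x) + c * snd (x /\<^sub>R norm x))\<^sup>2)
          = ennreal ((a * fst x + c * snd x)\<^sup>2)"
        by (simp add: ennreal_mult'[symmetric])
      moreover have "1 < ennreal ((a * fst x + c * snd x)\<^sup>2) \<longleftrightarrow> 1 < (a * fst x + c * snd x)\<^sup>2"
        by (simp add: ennreal_less_iff flip: ennreal_1)
      moreover have "1 < (a * fst x + c * snd x)\<^sup>2 \<longleftrightarrow> \<bar>a * fst x + c * snd x\<bar> > 1"
        using abs_square_le_1[of "a * fst x + c * snd x"] by linarith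
      ultimately show ?thesis using False by simp
    qed simp
    then show ?thesis by simp
  qed
  also have "emeasure (planar \<nu>) {x. \<bar>a * fst x + c * snd x\<bar> > 1} = ennreal ?q"
    by (rule planar_tail_linear[OF N X right_tail_tail_const[OF V]])
  finally have nn: "(\<integral>\<^sup>+\<omega>. ennreal ((a * fst \<omega> + c * snd \<omega>)\<^sup>2) \<partial>H) = ennreal ?q" .
  have "(\<integral>\<omega>. (a * fst \<omega> + c * snd \<omega>)\<^sup>2 \<partial>H) = ?q"
    using tail_const_nonneg[OF V] hm by (subst integral_eq_nn_integral) (auto simp: nn)
  moreover have "(\<integral>\<omega>. (a * fst \<omega> + c * snd \<omega>)\<^sup>2 \<partial>H)
     = (\<integral>\<omega>. a\<^sup>2 * (fst \<omega> * fst \<omega>) + 2 * a * c * (fst \<omega> * snd \<omega>) + c\<^sup>2 * (snd \<omega> * snd \<omega>) \<partial>H)"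
    by (intro Bochner_Integration.integral_cong) (simp_all add: power2_eq_square algebra_simps)
  moreover have "\<dots> = a\<^sup>2 * (\<integral>\<omega>. fst \<omega> * fst \<omega> \<partial>H) + 2 * a * c * (\<integral>\<omega>. fst \<omega> * snd \<omega> \<partial>H) + c\<^sup>2 * (\<integral>\<omega>. snd \<omega> * snd \<omega> \<partial>H)"
    using int[of fst fst] int[of fst snd] int[of snd snd] by simp
  ultimately show ?thesis by (simp add: power2_eq_square)
qed

lemma tail_pairwise_dependence_2:
  "tail_pairwise_dependence M b 2 X1 X2 = (\<integral>\<omega>. fst \<omega> * snd \<omega> \<partial>angular_measure M b 2 X1 X2)"
proof -
  have "sgn u * sgn v * \<bar>u\<bar> powr (2 / 2) * \<bar>v\<bar> powr (2 / 2) = u * v" for u v :: real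
    by (simp add: abs_mult_sgn sgn_if)
  then show ?thesis unfolding tail_pairwise_dependence_def by simp
qed

lemma tail_const_uminus: "tail_const (\<lambda>w. - X w) = tail_const X"
  by (simp add: tail_const_def)

section \<open>Equivalence classes and their norm\<close>

lemma W_space_class:
  assumes C: "C \<in> W_space M b" and X: "X \<in> C"
  shows "X \<in> V_space M b" "Y \<in> C \<longleftrightarrow> Y \<in> V_space M b \<and> (\<lambda>w. X w - Y w) \<in> N_space M b"
proof -
  obtain Z where Z: "Z \<in> V_space M b" "C = tail_rel M b `` {Z}"
    using C by (auto simp: W_space_def elim: quotientE)
  have ZX: "(\<lambda>w. Z w - X w) \<in> N_space M b" and XV: "X \<in> V_space M b"
    using X Z by (auto simp: tail_rel_def)
  show "X \<in> V_space M b" by (rule XV)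
  show "Y \<in> C \<longleftrightarrow> Y \<in> V_space M b \<and> (\<lambda>w. X w - Y w) \<in> N_space M b"
  proof
    assume "Y \<in> C"
    then have Y: "Y \<in> V_space M b" "(\<lambda>w. Z w - Y w) \<in> N_space M b"
      using Z by (auto simp: tail_rel_def)
    \<comment> \<open>X - Y is (Z - Y) - (Z - X): any member of a class can serve as its centre
      because null variables are closed under sums and scaling.\<close>
    from N_space_add[OF Y(2) N_space_scale[OF ZX, of "- 1"]] Y(1)
    show "Y \<in> V_space M b \<and> (\<lambda>w. X w - Y w) \<in> N_space M b" by (simp add: algebra_simps)
  next
    assume Y: "Y \<in> V_space M b \<and> (\<lambda>w. X w - Y w) \<in> N_space M b"
    with N_space_add[OF ZX, of "\<lambda>w. X w - Y w"] have "(\<lambda>w. Z w - Y w) \<in> N_space M b" by simp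
    with Y Z show "Y \<in> C" by (auto simp: tail_rel_def)
  qed
qed

lemma W_space_nonempty:
  assumes "C \<in> W_space M b" shows "\<exists>X. X \<in> C"
proof -
  obtain Z where "Z \<in> V_space M b" "C = tail_rel M b `` {Z}"
    using assms by (auto simp: W_space_def elim: quotientE)
  then have "Z \<in> C" using N_space_zero by (simp add: tail_rel_def)
  then show ?thesis by blast
qed

lemma W_space_eqI:
  assumes "C \<in> W_space M b" "D \<in> W_space M b" "X \<in> C" "X \<in> D" shows "C = D"
  using W_space_class(2)[OF assms(1,3)] W_space_class(2)[OF assms(2,4)] by blast

lemma W_norm_eq:
  assumes C: "C \<in> W_space M b" and X: "X \<in> C"
  shows "W_norm M b 2 C = sqrt (tail_const X)"
proof -
  have "V_norm M b 2 Y = sqrt (tail_const X)" if "Y \<in> C" for Y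
    using that W_space_class(1)[OF C X] W_space_class(2)[OF C X, of Y] tail_const_perturb[of X Y]
    by (simp add: V_norm_eq V_space_measurable)
  then have "V_norm M b 2 ` C = {sqrt (tail_const X)}" using X by auto
  then show ?thesis by (simp add: W_norm_def)
qed

lemma W_norm_squared:
  assumes C: "C \<in> W_space M b" and X: "X \<in> C"
  shows "(W_norm M b 2 C)\<^sup>2 = tail_const X"
  using tail_const_nonneg[OF W_space_class(1)[OF C X]] by (simp add: W_norm_eq[OF C X])

lemma N_space_uminus: "(\<lambda>w. - X w) \<in> N_space M b \<longleftrightarrow> X \<in> N_space M b"
  using N_space_scale[of X "- 1"] N_space_scale[of "\<lambda>w. - X w" "- 1"] by auto

lemma in_W_zero_iff: "X \<in> W_zero M b \<longleftrightarrow> X \<in> N_space M b"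
proof -
  have "(\<lambda>w. 0) \<in> V_space M b" using N_space_zero N_subset_V by blast
  then show ?thesis
    using N_subset_V by (auto simp: W_zero_def tail_rel_def N_space_uminus)
qed

end

section \<open>The inner product\<close>

locale regular_subspace = tail_setup M b for M :: "'a measure" and b +
  fixes S :: "('a \<Rightarrow> real) set set"
  assumes sub: "W_subspace M b S"
    and jrv: "\<forall>C1\<in>S. \<forall>C2\<in>S. \<not> (C1 = W_zero M b \<and> C2 = W_zero M b) \<longrightarrow>
           (\<exists>X1\<in>C1. \<exists>X2\<in>C2. jointly_regularly_varying M b X1 X2)"
begin

lemma S_W: "C \<in> S \<Longrightarrow> C \<in> W_space M b"
  and zero_S: "W_zero M b \<in> S"
  and add_S: "C \<in> S \<Longrightarrow> D \<in> S \<Longrightarrow> W_add M b C D \<in> S"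
  and scale_S: "C \<in> S \<Longrightarrow> W_scale M b a C \<in> S"
  using sub by (auto simp: W_subspace_def)

text \<open>A priori X + Y might lie outside \<open>V_space\<close> and contribute nothing to
  \<open>W_add\<close>. But the sum class belongs to S and is nonempty, so some pair of
  representatives has its sum in \<open>V_space\<close>, and X + Y differs from that sum by a null
  variable.\<close>

lemma W_add_mem:
  assumes C: "C \<in> S" "X \<in> C" and D: "D \<in> S" "Y \<in> D"
  shows "(\<lambda>w. X w + Y w) \<in> W_add M b C D"
proof -
  obtain Z where "Z \<in> W_add M b C D" using W_space_nonempty[OF S_W[OF add_S[OF C(1) D(1)]]] by blast
  then obtain X0 Y0 where XY0: "X0 \<in> C" "Y0 \<in> D" "(\<lambda>w. X0 w + Y0 w) \<in> V_space M b"
    by (auto simp: W_add_def tail_rel_def)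
  have "(\<lambda>w. X0 w - X w) \<in> N_space M b" "(\<lambda>w. Y0 w - Y w) \<in> N_space M b"
    using W_space_class(2)[OF S_W[OF C(1)] XY0(1)] W_space_class(2)[OF S_W[OF D(1)] XY0(2)] C(2) D(2) by auto
  from N_space_add[OF this] have N: "(\<lambda>w. (X0 w + Y0 w) - (X w + Y w)) \<in> N_space M b"
    by (simp add: algebra_simps)
  have "X \<in> borel_measurable M" "Y \<in> borel_measurable M"
    using W_space_class(1)[OF S_W[OF C(1)] C(2)] W_space_class(1)[OF S_W[OF D(1)] D(2)]
    by (auto intro: V_space_measurable)
  then have "(\<lambda>w. X w + Y w) \<in> V_space M b"
    by (intro V_space_perturb[OF XY0(3) _ N]) simp
  with N XY0 show ?thesis by (auto simp: W_add_def tail_rel_def)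
qed

lemma W_scale_mem:
  assumes C: "C \<in> S" "X \<in> C"
  shows "(\<lambda>w. a * X w) \<in> W_scale M b a C"
proof -
  have "(\<lambda>w. a * X w) \<in> V_space M b"
    by (rule V_space_scale[OF W_space_class(1)[OF S_W[OF C(1)] C(2)]])
  then show ?thesis using C(2) N_space_zero by (auto simp: W_scale_def tail_rel_def)
qed

text \<open>All representatives of elements of S. They are closed under genuine sums and multiples,
  so the algebra below is done on random variables instead of partially added classes.\<close>

definition U :: "('a \<Rightarrow> real) set" where "U = \<Union>S"

lemma U_V: "X \<in> U \<Longrightarrow> X \<in> V_space M b"
  using W_space_class(1) S_W by (auto simp: U_def)

lemma U_add: "X \<in> U \<Longrightarrow> Y \<in> U \<Longrightarrow> (\<lambda>w. X w + Y w) \<in> U"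
  unfolding U_def using W_add_mem add_S by blast

lemma U_scale: "X \<in> U \<Longrightarrow> (\<lambda>w. a * X w) \<in> U"
  unfolding U_def using W_scale_mem scale_S by blast

lemma U_diff: "X \<in> U \<Longrightarrow> Y \<in> U \<Longrightarrow> (\<lambda>w. X w - Y w) \<in> U"
  using U_add[OF _ U_scale[of Y "- 1"], of X] by simp

section \<open>Polarization of the squared norm on representatives\<close>

abbreviation tpd :: "('a \<Rightarrow> real) \<Rightarrow> ('a \<Rightarrow> real) \<Rightarrow> real" where
  "tpd \<equiv> tail_pairwise_dependence M b 2"

lemma tail_const_combination:
  assumes X: "X \<in> U" and Y: "Y \<in> U"
  shows "tail_const (\<lambda>w. a * X w + c * Y w) = a\<^sup>2 * tail_const X + 2 * a * c * tpd X Y + c\<^sup>2 * tail_const Y"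
\<comment> \<open>If both are null the hypothesis supplies no tail measure; the convention of a zero
  angular measure makes both sides vanish.\<close>
proof (cases "X \<in> N_space M b \<and> Y \<in> N_space M b")
  case True
  then have "(\<lambda>w. a * X w + c * Y w) \<in> N_space M b" by (intro N_space_add N_space_scale) auto
  then have "tail_const (\<lambda>w. a * X w + c * Y w) = 0" "tail_const X = 0" "tail_const Y = 0"
    using True by (simp_all add: N_space_iff tail_const_eq)
  moreover have "tpd X Y = 0"
    using True by (simp add: tail_pairwise_dependence_2 angular_measure_def)
  ultimately show ?thesis by simp
next
  case False
  obtain C D where CD: "C \<in> S" "X \<in> C" "D \<in> S" "Y \<in> D" using X Y by (auto simp: U_def)
  then have "\<not> (C = W_zero M b \<and> D = W_zero M b)" using False in_W_zero_iff by auto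
  then obtain X0 Y0 where XY0: "X0 \<in> C" "Y0 \<in> D" "jointly_regularly_varying M b X0 Y0"
    using jrv CD by blast
  then obtain \<nu> where nu0: "is_tail_measure M b X0 Y0 \<nu>"
    by (auto simp: jointly_regularly_varying_def)
  note X0 = W_space_class[OF S_W[OF CD(1)] XY0(1)] and Y0 = W_space_class[OF S_W[OF CD(3)] XY0(2)]
  have nu: "is_tail_measure M b X Y \<nu>"
    using X0(2)[of X] Y0(2)[of Y] CD
    by (intro is_tail_measure_perturb[OF nu0 X0(1) Y0(1)]) auto
  have "angular_measure M b 2 X Y = (THE H. is_angular_measure 2 (tail_measure M b X Y) H)"
    using False by (simp only: angular_measure_def if_False)
  then have H: "angular_measure M b 2 X Y = angular_of (planar \<nu>)"
    by (simp only: angular_measure_unique[OF U_V[OF X, THEN V_space_measurable] U_V[OF Y, THEN V_space_measurable] nu])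
  have quad: "tail_const (\<lambda>w. a * X w + c * Y w) =
     a\<^sup>2 * (\<integral>\<omega>. (fst \<omega>)\<^sup>2 \<partial>angular_of (planar \<nu>)) + 2 * a * c * tpd X Y + c\<^sup>2 * (\<integral>\<omega>. (snd \<omega>)\<^sup>2 \<partial>angular_of (planar \<nu>))" for a c
    unfolding tail_pairwise_dependence_2 H
    by (rule tail_const_quadratic[OF nu U_V[OF X] U_V[OF Y] U_V[OF U_add[OF U_scale[OF X] U_scale[OF Y]]]])
  \<comment> \<open>The coefficients 1, 0 and 0, 1 identify the integrals of the squared coordinates
    with the squared norms of X and Y.\<close>
  show ?thesis using quad[of a c] quad[of 1 0] quad[of 0 1] by simp
qed

lemma tail_const_add:
  "X \<in> U \<Longrightarrow> Y \<in> U \<Longrightarrow> tail_const (\<lambda>w. X w + Y w) = tail_const X + 2 * tpd X Y + tail_const Y"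
  using tail_const_combination[of X Y 1 1] by simp

lemma tail_const_diff:
  "X \<in> U \<Longrightarrow> Y \<in> U \<Longrightarrow> tail_const (\<lambda>w. X w - Y w) = tail_const X - 2 * tpd X Y + tail_const Y"
  using tail_const_combination[of X Y 1 "- 1"] by simp

lemma tpd_commute: "X \<in> U \<Longrightarrow> Y \<in> U \<Longrightarrow> tpd X Y = tpd Y X"
  using tail_const_add[of X Y] tail_const_add[of Y X] by (simp add: add.commute)

text \<open>q(a X + Y) is expanded once for the pair a X, Y and once for X, Y with coefficients a,
  1. As q(a X) = a^2 q(X), the cross terms agree, for every real a at once.\<close>

lemma tpd_scale:
  assumes "X \<in> U" "Y \<in> U" shows "tpd (\<lambda>w. a * X w) Y = a * tpd X Y"
  using tail_const_add[OF U_scale[OF assms(1), of a] assms(2)] tail_const_combination[OF assms, of a 1]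
    tail_const_combination[OF assms, of a 0] by simp

text \<open>q(X + X) = 4 q(X), so the cross term 2 \<open>tpd X X\<close> equals 2 q(X).\<close>

lemma tpd_self:
  assumes "X \<in> U" shows "tpd X X = tail_const X"
proof -
  have "tail_const (\<lambda>w. 2 * X w) = 4 * tail_const X"
    using tail_const_combination[OF assms assms, of 2 0] by simp
  then show ?thesis using tail_const_add[OF assms assms] by simp
qed

lemma parallelogram:
  "X \<in> U \<Longrightarrow> Y \<in> U \<Longrightarrow> tail_const (\<lambda>w. X w + Y w) + tail_const (\<lambda>w. X w - Y w) = 2 * tail_const X + 2 * tail_const Y"
  by (simp add: tail_const_add tail_const_diff)

text \<open>The Jordan-von Neumann argument, since no single limit measure covers three variables.
  Taking the four parallelogram identities \<open>e\<close> with signs +, -, +, - leaves twice q(X +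
  Y + Z) - q(X + Y - Z) on the left: the mixed terms cancel by \<open>g\<close>, their arguments
  being negatives of each other. Each difference of this kind is four times a value of
  \<open>tpd\<close>.\<close>

lemma tpd_add:
  assumes X: "X \<in> U" and Y: "Y \<in> U" and Z: "Z \<in> U"
  shows "tpd (\<lambda>w. X w + Y w) Z = tpd X Z + tpd Y Z"
proof -
  let ?q = tail_const
  have e: "?q (\<lambda>w. (X w + Z w) + Y w) + ?q (\<lambda>w. (X w + Z w) - Y w) = 2 * ?q (\<lambda>w. X w + Z w) + 2 * ?q Y"
    "?q (\<lambda>w. (X w - Z w) + Y w) + ?q (\<lambda>w. (X w - Z w) - Y w) = 2 * ?q (\<lambda>w. X w - Z w) + 2 * ?q Y"
    "?q (\<lambda>w. (Y w + Z w) + X w) + ?q (\<lambda>w. (Y w + Z w) - X w) = 2 * ?q (\<lambda>w. Y w + Z w) + 2 * ?q X"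
    "?q (\<lambda>w. (Y w - Z w) + X w) + ?q (\<lambda>w. (Y w - Z w) - X w) = 2 * ?q (\<lambda>w. Y w - Z w) + 2 * ?q X"
    by (intro parallelogram U_add U_diff X Y Z)+
  have f: "(\<lambda>w. (X w + Z w) + Y w) = (\<lambda>w. (X w + Y w) + Z w)" "(\<lambda>w. (Y w + Z w) + X w) = (\<lambda>w. (X w + Y w) + Z w)"
    "(\<lambda>w. (X w - Z w) + Y w) = (\<lambda>w. (X w + Y w) - Z w)" "(\<lambda>w. (Y w - Z w) + X w) = (\<lambda>w. (X w + Y w) - Z w)"
    by (auto simp: algebra_simps)
  have g: "?q (\<lambda>w. (X w + Z w) - Y w) = ?q (\<lambda>w. (Y w - Z w) - X w)"
    "?q (\<lambda>w. (X w - Z w) - Y w) = ?q (\<lambda>w. (Y w + Z w) - X w)"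
    using tail_const_uminus[of "\<lambda>w. (Y w - Z w) - X w"] tail_const_uminus[of "\<lambda>w. (Y w + Z w) - X w"]
    by (simp_all add: algebra_simps)
  note XY = U_add[OF X Y]
  show ?thesis
    using e[unfolded f g] tail_const_add[OF X Z] tail_const_diff[OF X Z] tail_const_add[OF Y Z] tail_const_diff[OF Y Z]
      tail_const_add[OF XY Z] tail_const_diff[OF XY Z] by linarith
qed

text \<open>Expanding \<open>ip\<close> on the sum of C and D expresses \<open>ip C D\<close> by
  three squared norms, and \<open>tail_const_add\<close> expresses \<open>tpd X Y\<close> by the
  same three.\<close>

lemma inner_product_unique:
  assumes ip: "W_inner_product M b S ip" and norm: "W_induces_norm M b 2 S ip"
    and C: "C \<in> S" "X \<in> C" and D: "D \<in> S" "Y \<in> D"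
  shows "ip C D = tpd X Y"
proof -
  have q: "ip E E = tail_const Z" if E: "E \<in> S" "Z \<in> E" for E Z
  proof -
    have "W_norm M b 2 E = sqrt (ip E E)" "ip E E \<ge> 0"
      using ip norm E(1) by (auto simp: W_inner_product_def W_induces_norm_def)
    then show ?thesis using W_norm_squared[OF S_W[OF E(1)] E(2)] by simp
  qed
  define E where "E = W_add M b C D"
  have E: "E \<in> S" "(\<lambda>w. X w + Y w) \<in> E"
    unfolding E_def by (intro add_S W_add_mem C D)+
  have add: "ip E F = ip C F + ip D F" if "F \<in> S" for F
    using ip C(1) D(1) that by (simp add: E_def W_inner_product_def)
  have sym: "ip F G = ip G F" if "F \<in> S" "G \<in> S" for F G
    using conjunct1[OF ip[unfolded W_inner_product_def]] that by blast
  have "ip E E = ip E C + ip E D" using add[OF E(1)] sym[OF E(1)] C(1) D(1) by simp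
  also have "\<dots> = ip C C + 2 * ip C D + ip D D"
    using add[OF C(1)] add[OF D(1)] sym[OF C(1) D(1)] by simp
  finally have "tail_const (\<lambda>w. X w + Y w) = tail_const X + 2 * ip C D + tail_const Y"
    by (simp add: q[OF E] q[OF C] q[OF D])
  moreover have "X \<in> U" "Y \<in> U" using C D by (auto simp: U_def)
  ultimately show ?thesis using tail_const_add[of X Y] by simp
qed

text \<open>Polarization written with class norms is independent of representatives by construction;
  its agreement with \<open>tpd\<close> then shows the same for \<open>tpd\<close>.\<close>

definition polar_form :: "('a \<Rightarrow> real) set \<Rightarrow> ('a \<Rightarrow> real) set \<Rightarrow> real" where
  "polar_form C D = ((W_norm M b 2 (W_add M b C D))\<^sup>2 - (W_norm M b 2 C)\<^sup>2 - (W_norm M b 2 D)\<^sup>2) / 2"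

lemma polar_form_eq:
  assumes C: "C \<in> S" "X \<in> C" and D: "D \<in> S" "Y \<in> D"
  shows "polar_form C D = tpd X Y"
proof -
  have "X \<in> U" "Y \<in> U" using C D by (auto simp: U_def)
  then show ?thesis
    unfolding polar_form_def W_norm_squared[OF S_W[OF add_S[OF C(1) D(1)]] W_add_mem[OF C D]]
      W_norm_squared[OF S_W[OF C(1)] C(2)] W_norm_squared[OF S_W[OF D(1)] D(2)]
    by (simp add: tail_const_add)
qed

lemma representative:
  assumes "C \<in> S" obtains X where "X \<in> C" "X \<in> U"
  using assms W_space_nonempty[OF S_W[OF assms]] by (auto simp: U_def)

lemma polar_form_inner_product: "W_inner_product M b S polar_form"
  unfolding W_inner_product_def
proof (intro conjI ballI allI)
  fix C D assume C: "C \<in> S" and D: "D \<in> S"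
  obtain X Y where X: "X \<in> C" "X \<in> U" and Y: "Y \<in> D" "Y \<in> U"
    using representative[OF C] representative[OF D] by metis
  show "polar_form C D = polar_form D C"
    using tpd_commute[OF X(2) Y(2)] by (simp add: polar_form_eq[OF C X(1) D Y(1)] polar_form_eq[OF D Y(1) C X(1)])
  show "polar_form (W_scale M b a C) D = a * polar_form C D" for a
    using tpd_scale[OF X(2) Y(2)]
    by (simp add: polar_form_eq[OF C X(1) D Y(1)] polar_form_eq[OF scale_S[OF C] W_scale_mem[OF C X(1)] D Y(1)])
  fix E assume E: "E \<in> S"
  obtain Z where Z: "Z \<in> E" "Z \<in> U" using representative[OF E] .
  show "polar_form (W_add M b C D) E = polar_form C E + polar_form D E"
    using tpd_add[OF X(2) Y(2) Z(2)]
    by (simp add: polar_form_eq[OF C X(1) E Z(1)] polar_form_eq[OF D Y(1) E Z(1)]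
        polar_form_eq[OF add_S[OF C D] W_add_mem[OF C X(1) D Y(1)] E Z(1)])
next
  fix C assume C: "C \<in> S"
  obtain X where X: "X \<in> C" "X \<in> U" using representative[OF C] .
  have p: "polar_form C C = tail_const X"
    by (simp add: polar_form_eq[OF C X(1) C X(1)] tpd_self[OF X(2)])
  show "polar_form C C \<ge> 0" unfolding p by (rule tail_const_nonneg[OF U_V[OF X(2)]])
  \<comment> \<open>A class sharing a representative with the zero class equals it, so definiteness
    reduces to \<open>q\<close> vanishing only on null variables.\<close>
  have "X \<in> W_zero M b \<longleftrightarrow> C = W_zero M b"
    using W_space_eqI[OF S_W[OF C] S_W[OF zero_S] X(1)] X(1) by auto
  then show "polar_form C C = 0 \<longleftrightarrow> C = W_zero M b"
    by (simp add: p tail_const_zero_iff[OF U_V[OF X(2)]] in_W_zero_iff)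
qed

lemma polar_form_norm: "W_induces_norm M b 2 S polar_form"
  unfolding W_induces_norm_def
proof
  fix C assume C: "C \<in> S"
  obtain X where X: "X \<in> C" "X \<in> U" using representative[OF C] .
  show "W_norm M b 2 C = sqrt (polar_form C C)"
    by (simp add: W_norm_eq[OF S_W[OF C] X(1)] polar_form_eq[OF C X(1) C X(1)] tpd_self[OF X(2)])
qed

end

theorem corollary1:
  fixes M :: "'a measure" and b :: "real \<Rightarrow> real" and S :: "('a \<Rightarrow> real) set set"
  assumes "prob_space M"
    and "normalizing_function b 2"
    and "W_subspace M b S"
    and "\<forall>C1\<in>S. \<forall>C2\<in>S. \<not> (C1 = W_zero M b \<and> C2 = W_zero M b) \<longrightarrow>
           (\<exists>X1\<in>C1. \<exists>X2\<in>C2. jointly_regularly_varying M b X1 X2)"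
  shows "(\<exists>ip. W_inner_product M b S ip \<and> W_induces_norm M b 2 S ip) \<and>
    (\<forall>ip. W_inner_product M b S ip \<and> W_induces_norm M b 2 S ip \<longrightarrow>
      (\<forall>C1\<in>S. \<forall>C2\<in>S. \<forall>X1\<in>C1. \<forall>X2\<in>C2.
         ip C1 C2 = tail_pairwise_dependence M b 2 X1 X2 \<and>
         tail_pairwise_dependence M b 2 X1 X2 = (\<integral>\<omega>. fst \<omega> * snd \<omega> \<partial>angular_measure M b 2 X1 X2)))"
proof -
  interpret regular_subspace M b S
    using assms by (simp add: regular_subspace_def tail_setup_def tail_setup_axioms_def regular_subspace_axioms_def)
  show ?thesis
    using polar_form_inner_product polar_form_norm inner_product_unique tail_pairwise_dependence_2 by blast
qed

end
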